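(* Let $d\ge1$, let $w_1,\dots,w_d\in\mathbb C$ satisfy $\Re(w_i)>0$ for $i=1,\dots,d$, and put $\bm w=(w_1,\dots,w_d)$. Then $$\begin{aligned} \zeta_{\rm Bh}'(0|\bm w)={}&\frac{1}{\prod_{i=1}^dw_i}\sum_{j=0}^{d-1}\frac{(-1)^{j+1}B_j(\bm w)}{j!\,(d-j)!\,(d-j)}\\ &+\int_0^\infty t^{-1}\Biggl(\frac{1}{\prod_{i=1}^d(1-{\rm e}^{-w_it})}-1+{\rm e}^{-t}-\frac{t^{-d}{\rm e}^{-t}}{\prod_{i=1}^dw_i}\sum_{k=0}^d(-1)^kB_k(-1|\bm w)\frac{t^k}{k!}\Biggr){\rm d}t . \end{aligned}$$
   Context: $\log$ is the principal branch on the right half-plane and $z^s=\exp(s\log z)$. $\mathbb N_0=\{0,1,2,\dots\}$, $\bm n\cdot\bm w=\sum_{i=1}^dn_iw_i$. The homogeneous Barnes zeta function is $\zeta_{\rm Bh}(\alpha|\bm w)=\sum_{\bm n\in\mathbb N_0^d\setminus\{\bm 0\}}(\bm n\cdot\bm w)^{-\alpha}$ for $\Re(\alpha)>d$; it extends meromorphically in $\alpha$ to $\mathbb C$, with at most simple poles, located at $\alpha=1,\dots,d$. The prime in $\zeta_{\rm Bh}'$ denotes the derivative with respect to $\alpha$. The higher order Bernoulli polynomials $B_n(x|\bm w)$ are defined by $z^d{\rm e}^{xz}\prod_{i=1}^d\frac{w_i}{{\rm e}^{w_iz}-1}=\sum_{n\ge0}B_n(x|\bm w)\frac{z^n}{n!}$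 for $|z|<2\pi/\max_i|w_i|$, and the higher order Bernoulli numbers are $B_k(\bm w)=B_k(0|\bm w)$. *)

theory Defs
  imports "HOL-Complex_Analysis.Complex_Analysis"
begin

text \<open>
  A vector \<open>(w\<^sub>1, \<dots>, w\<^sub>d)\<close> is a function on \<open>nat\<close> of which only the values on \<open>{1..d}\<close> are used.
  Multi-indices are extensional functions, i.e. \<^term>\<open>undefined\<close> outside \<open>{1..d}\<close>, so that each one
  is summed exactly once; the multi-index 0 is therefore \<^term>\<open>\<lambda>i\<in>{1..d}. 0 :: nat\<close>.
\<close>

definition barnes_series_h :: "nat \<Rightarrow> (nat \<Rightarrow> complex) \<Rightarrow> complex \<Rightarrow> complex" where
  "barnes_series_h d w \<alpha> =
     (\<Sum>\<^sub>\<infinity>n \<in> ({1..d} \<rightarrow>\<^sub>E (UNIV :: nat set)) - {\<lambda>i\<in>{1..d}. 0}.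
        (\<Sum>i=1..d. of_nat (n i) * w i) powr (- \<alpha>))"

text \<open>
  The meromorphic continuation to the whole plane. \<^const>\<open>nicely_meromorphic_on\<close> fixes the otherwise
  arbitrary values at the poles (0) and at removable singularities (the limit), which makes the
  continuation unique, see \<open>barnes_continuation_unique\<close> below.
\<close>

definition barnes_zeta_h :: "nat \<Rightarrow> (nat \<Rightarrow> complex) \<Rightarrow> complex \<Rightarrow> complex" where
  "barnes_zeta_h d w =
     (THE Z. Z nicely_meromorphic_on UNIV \<and>
             (\<forall>\<alpha>. Re \<alpha> > real d \<longrightarrow> Z \<alpha> = barnes_series_h d w \<alpha>))"

text \<open>
  The generating function of the higher order Bernoulli polynomials as a formal power series.
  One factor \<^const>\<open>fps_X\<close> of the numerator goes to each denominator, whose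
  constant coefficient is 0: dividing by the latter alone would leave the ring of power series.
  That the expansion is valid in the usual disc is \<open>bernoulli_poly_ho_sums\<close> below.
\<close>

definition bernoulli_poly_ho :: "nat \<Rightarrow> (nat \<Rightarrow> complex) \<Rightarrow> nat \<Rightarrow> complex \<Rightarrow> complex" where
  "bernoulli_poly_ho d w n x =
     fact n * fps_nth (fps_exp x * (\<Prod>i=1..d. fps_X * fps_const (w i) / (fps_exp (w i) - 1))) n"

definition bernoulli_num_ho :: "nat \<Rightarrow> (nat \<Rightarrow> complex) \<Rightarrow> nat \<Rightarrow> complex" where
  "bernoulli_num_ho d w n = bernoulli_poly_ho d w n 0"


lemma barnes_continuation_unique:
  assumes f: "f nicely_meromorphic_on UNIV" and g: "g nicely_meromorphic_on UNIV"
  assumes eq: "\<And>\<alpha>. Re \<alpha> > c \<Longrightarrow> f \<alpha> = g \<alpha>"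
  shows "f = g"
proof
  fix z
  define h where "h = (\<lambda>z. f z - g z)"
  have "h meromorphic_on UNIV"
    using f g unfolding h_def nicely_meromorphic_on_def by (auto intro!: meromorphic_intros)
  hence alt: "eventually (\<lambda>z. h z = 0) (cosparse UNIV) \<or> eventually (\<lambda>z. h z \<noteq> 0) (cosparse UNIV)"
    by (rule meromorphic_imp_constant_or_avoid) auto
  have "\<not>eventually (\<lambda>z. h z \<noteq> 0) (cosparse UNIV)"
  proof
    assume "eventually (\<lambda>z. h z \<noteq> 0) (cosparse UNIV)"
    hence "eventually (\<lambda>z. h z \<noteq> 0) (at (of_real (c + 1)))"
      by (auto simp: eventually_cosparse_open_eq)
    moreover have "eventually (\<lambda>z. z \<in> {z. Re z > c}) (at (of_real (c + 1)))"
      by (intro eventually_at_in_open') (auto simp: open_halfspace_Re_gt)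
    ultimately have "eventually (\<lambda>z::complex. False) (at (of_real (c + 1)))"
      by eventually_elim (use eq in \<open>auto simp: h_def\<close>)
    thus False by simp
  qed
  with alt have ev: "eventually (\<lambda>x. f x = g x) (at z)"
    by (auto simp: eventually_cosparse_open_eq h_def)
  have pole: "is_pole f z \<longleftrightarrow> is_pole g z"
    by (rule is_pole_cong[OF ev]) auto
  have lim: "(f \<longlongrightarrow> L) (at z) \<longleftrightarrow> (g \<longlongrightarrow> L) (at z)" for L
    by (rule filterlim_cong[OF refl refl ev])
  have f': "is_pole f z \<and> f z = 0 \<or> (f \<longlongrightarrow> f z) (at z)"
   and g': "is_pole g z \<and> g z = 0 \<or> (g \<longlongrightarrow> g z) (at z)"
    using f g by (auto simp: nicely_meromorphic_on_def)
  have no: "\<not>(is_pole g z \<and> (g \<longlongrightarrow> L) (at z))" for L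
    unfolding is_pole_def using not_tendsto_and_filterlim_at_infinity[of "at z" g L]
      trivial_limit_at[of z] by blast
  show "f z = g z"
  proof (cases "is_pole g z")
    case True
    hence "f z = 0" "g z = 0"
      using f' g' no pole lim by blast+
    thus ?thesis by simp
  next
    case False
    hence "(g \<longlongrightarrow> f z) (at z)" "(g \<longlongrightarrow> g z) (at z)"
      using f' g' pole lim by blast+
    thus ?thesis
      by (rule tendsto_unique[rotated]) auto
  qed
qed

lemma barnes_zeta_h_eqI:
  assumes "Z nicely_meromorphic_on UNIV"
  assumes "\<And>\<alpha>. Re \<alpha> > real d \<Longrightarrow> Z \<alpha> = barnes_series_h d w \<alpha>"
  shows "barnes_zeta_h d w = Z"
  unfolding barnes_zeta_h_def
proof (rule the_equality)
  fix Y assume Y: "Y nicely_meromorphic_on UNIV \<and>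
                   (\<forall>\<alpha>. Re \<alpha> > real d \<longrightarrow> Y \<alpha> = barnes_series_h d w \<alpha>)"
  show "Y = Z"
  proof (rule barnes_continuation_unique)
    show "Y \<alpha> = Z \<alpha>" if "Re \<alpha> > real d" for \<alpha>
      using Y assms(2)[OF that] that by simp
  qed (use Y assms(1) in blast)+
qed (use assms in blast)

lemma bernoulli_poly_ho_sums:
  assumes w: "\<And>i. i \<in> {1..d} \<Longrightarrow> w i \<noteq> 0"
  assumes z: "z \<noteq> 0" "\<And>i. i \<in> {1..d} \<Longrightarrow> norm z < 2 * pi / norm (w i)"
  shows "(\<lambda>n. bernoulli_poly_ho d w n x * z ^ n / fact n) sums
           (z ^ d * exp (x * z) * (\<Prod>i=1..d. w i / (exp (w i * z) - 1)))"
proof -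
  define R where "R = Min (insert (norm z + 1) ((\<lambda>i. 2 * pi / norm (w i)) ` {1..d}))"
  have zR: "norm z < R"
    using z unfolding R_def by auto
  have R_le: "R \<le> 2 * pi / norm (w i)" if "i \<in> {1..d}" for i
    unfolding R_def using that by (intro Min_le) auto
  define b where "b = (\<lambda>i u. if u = 0 then 1 else u * w i / (exp (w i * u) - 1))"
  define F where "F = (\<lambda>i. fps_X * fps_const (w i) / (fps_exp (w i) - 1 :: complex fps))"
  have nz: "exp (w i * u) - 1 \<noteq> 0" if i: "i \<in> {1..d}" and u: "u \<noteq> 0" "norm u < R" for i u
  proof
    assume "exp (w i * u) - 1 = 0"
    then obtain k :: int where k: "Re (w i * u) = 0" "Im (w i * u) = of_int (2 * k) * pi"
      by (auto simp: exp_eq_1)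
    have "norm (w i * u) = \<bar>Im (w i * u)\<bar>"
      using k(1) by (simp add: cmod_eq_Im)
    also have "\<dots> = 2 * pi * \<bar>of_int k\<bar>"
      using k(2) by (simp add: abs_mult)
    finally have eq: "norm (w i * u) = 2 * pi * \<bar>of_int k\<bar>" .
    have "norm (w i * u) < 2 * pi"
      using less_le_trans[OF u(2) R_le[OF i]] w[OF i] by (simp add: norm_mult field_simps)
    hence "\<bar>of_int k :: real\<bar> < 1"
      using eq by simp
    hence "k = 0" by linarith
    hence "w i * u = 0" using eq by simp
    thus False using w[OF i] u by simp
  qed
  have b: "b i has_fps_expansion F i" if i: "i \<in> {1..d}" for i
  proof -
    have sub: "subdegree (fps_exp (w i) - 1 :: complex fps) = 1"
      using w[OF i] by (intro subdegreeI) auto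
    show ?thesis unfolding b_def F_def
    proof (rule has_fps_expansion_divide)
      show "(\<lambda>u. u * w i) has_fps_expansion fps_X * fps_const (w i)"
        by (intro fps_expansion_intros)
      show "(\<lambda>u. exp (w i * u) - 1) has_fps_expansion fps_exp (w i) - 1"
        by (intro fps_expansion_intros)
      show "subdegree (fps_exp (w i) - 1 :: complex fps) \<le> subdegree (fps_X * fps_const (w i))"
        using w[OF i] sub by simp
      show "fps_exp (w i) - 1 \<noteq> (0 :: complex fps)"
        using sub by auto
      show "1 = fps_nth (fps_X * fps_const (w i)) (subdegree (fps_exp (w i) - 1)) /
                fps_nth (fps_exp (w i) - 1 :: complex fps) (subdegree (fps_exp (w i) - 1))"
        unfolding sub using w[OF i] by simp
    qed
  qed
  define h where "h = (\<lambda>u. exp (x * u) * (\<Prod>i=1..d. b i u))"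
  define H where "H = fps_exp x * (\<Prod>i=1..d. F i)"
  have H: "h has_fps_expansion H"
    unfolding h_def H_def by (intro fps_expansion_intros b)
  have holo_b: "b i holomorphic_on ball 0 R" if i: "i \<in> {1..d}" for i
  proof (rule no_isolated_singularity')
    show "(b i \<longlongrightarrow> b i u) (at u within ball 0 R)" if "u \<in> {0}" for u
      using has_fps_expansion_imp_continuous[OF b[OF i], of UNIV] that
      by (auto simp: continuous_within intro: tendsto_within_subset)
    have "(\<lambda>u. u * w i / (exp (w i * u) - 1)) holomorphic_on ball 0 R - {0}"
      by (intro holomorphic_intros) (use nz[OF i] in auto)
    thus "b i holomorphic_on ball 0 R - {0}"
      by (rule holomorphic_transform) (auto simp: b_def)
  qed auto
  have "h holomorphic_on ball 0 R"
    unfolding h_def by (intro holomorphic_intros holo_b)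
  hence "(\<lambda>n. fps_nth H n * z ^ n) sums h z"
    by (intro has_fps_expansion_imp_sums_complex[OF H, where r = "ereal R"]) (use zR in auto)
  moreover have "h z = z ^ d * exp (x * z) * (\<Prod>i=1..d. w i / (exp (w i * z) - 1))"
    using z(1) by (simp add: h_def b_def prod.distrib prod_dividef)
  ultimately show ?thesis
    by (simp add: bernoulli_poly_ho_def H_def F_def)
qed

end

theory Submission
  imports Defs
begin

text \<open>
  For \<open>Re \<alpha> > d\<close>, expanding \<open>K(t) = 1 / \<Prod>\<^sub>i (1 - exp (- w\<^sub>i t)) - 1\<close> into geometric series shows that
  \<open>\<Gamma>(\<alpha>) \<zeta>(\<alpha>)\<close> is the Mellin transform of \<open>K\<close>. Near 0 we have \<open>K(t) = t\<^sup>-\<^sup>d exp (- t) \<Sum>\<^sub>m a\<^sub>m t\<^sup>m\<close>; taking \<open>M\<close> terms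
  of this expansion away from \<open>K\<close> leaves a remainder whose Mellin transform is holomorphic for
  \<open>Re \<alpha> > d - M\<close>, while each term contributes \<open>a\<^sub>m \<Gamma>(\<alpha> + m - d) / \<Gamma>(\<alpha>)\<close>, a rational function.
  The resulting continuations for different \<open>M\<close> agree, as their difference is again a Gamma integral.
  At 0, \<open>1/\<Gamma>\<close> has a zero with derivative 1, so for \<open>M = d + 1\<close> the remainder contributes its Mellin
  transform at 0 to the derivative, and the term with \<open>j = d - m\<close> contributes
  \<open>a\<^sub>d\<^sub>-\<^sub>j (-1)\<^sup>j H\<^sub>j / j!\<close> with the harmonic number \<open>H\<^sub>j\<close>. Rewriting the \<open>a\<^sub>m\<close> in
  Bernoulli numbers and using \<open>\<Sum>\<^sub>j (-1)\<^sup>j (n choose j) H\<^sub>j = -1/n\<close> gives the finite sum.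
\<close>

section \<open>Mellin transforms\<close>

text \<open>Only \<open>K\<close> itself has to be dominated, locally uniformly in \<open>z\<close>:
  Cauchy's inequality turns that bound into one for the derivative in \<open>z\<close>. The
  difference quotients are then dominated too, and dominated convergence differentiates under the
  integral.\<close>

lemma holomorphic_on_lebesgue_integral:
  fixes K :: "complex \<Rightarrow> 'a \<Rightarrow> complex"
  assumes S: "open S"
  assumes meas: "\<And>z. z \<in> S \<Longrightarrow> K z \<in> borel_measurable M"
  assumes holo: "\<And>t. t \<in> space M \<Longrightarrow> (\<lambda>z. K z t) holomorphic_on S"
  assumes dom: "\<And>z. z \<in> S \<Longrightarrow> \<exists>e>0. \<exists>g. integrable M g \<and>
                  (\<forall>u\<in>ball z e \<inter> S. \<forall>t\<in>space M. norm (K u t) \<le> g t)"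
  shows "(\<lambda>z. \<integral>t. K z t \<partial>M) holomorphic_on S"
  unfolding holomorphic_on_open[OF S]
proof
  fix z assume z: "z \<in> S"
  obtain e g where e: "e > 0" and g: "integrable M g"
    and bd: "\<And>u t. u \<in> ball z e \<Longrightarrow> u \<in> S \<Longrightarrow> t \<in> space M \<Longrightarrow> norm (K u t) \<le> g t"
    using dom[OF z] by blast
  obtain r0 where r0: "r0 > 0" "ball z r0 \<subseteq> S"
    using S z openE by blast
  define r where "r = min e r0"
  have r: "r > 0" "ball z r \<subseteq> S" "ball z r \<subseteq> ball z e"
    using e r0 by (auto simp: r_def)
  define D where "D = (\<lambda>t. deriv (\<lambda>z. K z t) z)"
  \<comment> \<open>Discs of radius \<open>r/4\<close> about points of \<open>ball z (r/2)\<close>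
    stay inside \<open>ball z r\<close>, so Cauchy's inequality bounds the derivative there by
    \<open>g t / (r/4)\<close>; the mean value inequality gives the Lipschitz constant.\<close>
  have lip: "norm (K (z + h) t - K z t) \<le> 4 / r * g t * norm h"
    if t: "t \<in> space M" and h: "norm h < r / 2" for t h
  proof -
    have "norm (K (z + h) t - K z t) \<le> 4 / r * g t * norm (z + h - z)"
    proof (rule field_differentiable_bound[where S = "ball z (r/2)"])
      fix y assume y: "y \<in> ball z (r/2)"
      have y': "y \<in> S" using y r by auto
      show "((\<lambda>z. K z t) has_field_derivative deriv (\<lambda>z. K z t) y) (at y within ball z (r/2))"
        using holomorphic_derivI[OF holo[OF t] S y'] by (rule has_field_derivative_at_within)
      have sub: "cball y (r/4) \<subseteq> ball z r"
      proof
        fix x assume "x \<in> cball y (r/4)"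
        hence "dist z x < r"
          using y dist_triangle[of z x y] r(1) by auto
        thus "x \<in> ball z r" by simp
      qed
      have subS: "cball y (r/4) \<subseteq> S" using sub r(2) by blast
      have "norm ((deriv ^^ 1) (\<lambda>z. K z t) y) \<le> fact 1 * g t / (r/4) ^ 1"
      proof (rule Cauchy_inequality)
        show "(\<lambda>z. K z t) holomorphic_on ball y (r/4)"
          by (rule holomorphic_on_subset[OF holo[OF t]]) (use subS ball_subset_cball in blast)
        show "continuous_on (cball y (r/4)) (\<lambda>z. K z t)"
          by (rule holomorphic_on_imp_continuous_on, rule holomorphic_on_subset[OF holo[OF t]])
             (use subS in blast)
        show "norm (K x t) \<le> g t" if "norm (y - x) = r/4" for x
        proof -
          have "x \<in> cball y (r/4)" using that by (simp add: dist_norm)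
          thus ?thesis using sub subS r(3) bd[of x t] t by blast
        qed
      qed (use r in auto)
      thus "norm (deriv (\<lambda>z. K z t) y) \<le> 4 / r * g t" by (simp add: field_simps)
    qed (use h r in \<open>auto simp: dist_norm\<close>)
    thus ?thesis by simp
  qed
  have "((\<lambda>h. ((\<integral>t. K (z + h) t \<partial>M) - (\<integral>t. K z t \<partial>M)) / h) \<longlongrightarrow> (\<integral>t. D t \<partial>M)) (at 0)"
    unfolding tendsto_at_iff_sequentially
  proof (intro allI impI)
    fix X :: "nat \<Rightarrow> complex"
    assume X0: "\<forall>i. X i \<in> UNIV - {0}" and X: "X \<longlonglongrightarrow> 0"
    obtain N where N: "\<And>n. n \<ge> N \<Longrightarrow> norm (X n) < r / 2"
      using LIMSEQ_D[OF X, of "r/2"] r by auto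
    \<comment> \<open>Dominated convergence works with sequences, and the Lipschitz bound needs
      increments below \<open>r/2\<close>; so a tail of \<open>X\<close> is used and the offset
      removed at the end.\<close>
    define Y where "Y = (\<lambda>n. X (n + N))"
    have Y: "Y \<longlonglongrightarrow> 0" "\<And>n. Y n \<noteq> 0" "\<And>n. norm (Y n) < r / 2"
      using LIMSEQ_ignore_initial_segment[OF X] X0 N by (auto simp: Y_def)
    have YS: "z + Y n \<in> S" "z + Y n \<in> ball z e" for n
    proof -
      have "z + Y n \<in> ball z r" using Y(3)[of n] r(1) by (auto simp: dist_norm)
      thus "z + Y n \<in> S" "z + Y n \<in> ball z e" using r by auto
    qed
    have int: "integrable M (K u)" if "u \<in> S" "u \<in> ball z e" for u
      by (rule Bochner_Integration.integrable_bound[OF g meas[OF that(1)]])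
         (intro AE_I2, use bd[OF that(2,1)] in force)
    have lim: "(\<lambda>n. (K (z + Y n) t - K z t) / Y n) \<longlonglongrightarrow> D t" if t: "t \<in> space M" for t
    proof -
      have "((\<lambda>h. (K (z + h) t - K z t) / h) \<longlongrightarrow> D t) (at 0)"
        using holomorphic_derivI[OF holo[OF t] S z, of UNIV] unfolding DERIV_def D_def by simp
      from this[unfolded tendsto_at_iff_sequentially, rule_format, of Y]
      show ?thesis using Y by (simp add: o_def)
    qed
    have ms: "(\<lambda>t. (K (z + Y n) t - K z t) / Y n) \<in> borel_measurable M" for n
      using meas[OF YS(1)[of n]] meas[OF z] by measurable
    have "(\<lambda>n. \<integral>t. (K (z + Y n) t - K z t) / Y n \<partial>M) \<longlonglongrightarrow> (\<integral>t. D t \<partial>M)"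
    proof (rule integral_dominated_convergence[where w = "\<lambda>t. 4 / r * g t"])
      show "D \<in> borel_measurable M"
        by (rule borel_measurable_LIMSEQ_metric[OF ms lim])
      show "AE t in M. norm ((K (z + Y n) t - K z t) / Y n) \<le> 4 / r * g t" for n
      proof (intro AE_I2)
        fix t assume "t \<in> space M"
        from lip[OF this Y(3)[of n]] show "norm ((K (z + Y n) t - K z t) / Y n) \<le> 4 / r * g t"
          using Y(2)[of n] by (simp add: norm_divide pos_divide_le_eq)
      qed
    qed (use g ms lim in \<open>auto intro!: AE_I2\<close>)
    also have "(\<lambda>n. \<integral>t. (K (z + Y n) t - K z t) / Y n \<partial>M) = (\<lambda>n.
        ((\<integral>t. K (z + Y n) t \<partial>M) - (\<integral>t. K z t \<partial>M)) / Y n)"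
      using int[OF YS] int[OF z] e by simp
    finally have "(\<lambda>n. ((\<lambda>h. ((\<integral>t. K (z + h) t \<partial>M) - (\<integral>t. K z t \<partial>M)) / h) \<circ> X) (n + N))
                        \<longlonglongrightarrow> (\<integral>t. D t \<partial>M)"
      by (simp add: Y_def o_def)
    thus "((\<lambda>h. ((\<integral>t. K (z + h) t \<partial>M) - (\<integral>t. K z t \<partial>M)) / h) \<circ> X) \<longlonglongrightarrow> (\<integral>t. D t \<partial>M)"
      by (rule LIMSEQ_offset)
  qed
  thus "\<exists>f'. ((\<lambda>z. \<integral>t. K z t \<partial>M) has_field_derivative f') (at z)"
    unfolding DERIV_def by blast
qed

definition mellin :: "(real \<Rightarrow> complex) \<Rightarrow> complex \<Rightarrow> complex" where
  "mellin f \<alpha> = (LBINT t:{0<..}. of_real t powr (\<alpha> - 1) * f t)"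

lemma norm_of_real_powr: "t > 0 \<Longrightarrow> norm (complex_of_real t powr z) = t powr Re z"
  by (simp add: norm_powr_real_powr)

text \<open>Euler's integral enters through the completed measure \<open>lebesgue\<close>, while
  Fubini is applied over \<open>lborel\<close>. For Borel functions integrability is the same for
  both.\<close>

lemma set_integrable_lborel_of_lebesgue:
  fixes f :: "real \<Rightarrow> 'b :: euclidean_space"
  assumes "set_integrable lebesgue A f" "set_borel_measurable lborel A f"
  shows "set_integrable lborel A f"
  using assms integrable_completion[of "\<lambda>t. indicator A t *\<^sub>R f t" lborel]
  unfolding set_integrable_def set_borel_measurable_def by simp

lemma set_borel_measurable_continuous_lborel:
  fixes f :: "real \<Rightarrow> 'b :: euclidean_space"
  assumes "continuous_on A f" "A \<in> sets borel"
  shows "set_borel_measurable lborel A f"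
  using borel_measurable_continuous_on_indicator[OF assms(2,1)]
  unfolding set_borel_measurable_def by simp

lemma set_integrable_powr_exp:
  fixes s c :: real
  assumes "s > 0" "c > 0"
  shows "set_integrable lborel {0<..} (\<lambda>t. t powr (s - 1) * exp (- (c * t)))"
proof (rule set_integrable_lborel_of_lebesgue)
  have "set_integrable lebesgue {0<..} (\<lambda>t. norm (complex_of_real t powr (of_real s - 1) / of_real (exp (c * t))))"
    using absolutely_integrable_Gamma_integral[of "of_real s" c] assms by (intro set_integrable_norm) auto
  also have "?this \<longleftrightarrow> set_integrable lebesgue {0<..} (\<lambda>t. t powr (s - 1) * exp (- (c * t)))"
    by (intro set_integrable_cong) (auto simp: norm_divide norm_of_real_powr exp_minus field_simps)
  finally show \<dots> .
qed (auto intro!: set_borel_measurable_continuous_lborel continuous_intros)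

lemma continuous_on_of_real_powr [continuous_intros]:
  "continuous_on {0<..} (\<lambda>t. complex_of_real t powr z)"
  by (rule continuous_on_powr_complex) (auto intro!: continuous_intros simp: complex_nonneg_Reals_iff)

text \<open>The larger exponent dominates for \<open>t \<ge> 1\<close>, the smaller one for
  \<open>t < 1\<close>. This yields one dominating function for a whole vertical strip of
  \<alpha>.\<close>

lemma powr_le_sum:
  fixes t :: real
  assumes "t > 0" "a \<le> x" "x \<le> b"
  shows "t powr x \<le> t powr a + t powr b"
proof (cases "t \<ge> 1")
  case True
  hence "t powr x \<le> t powr b" using assms by (intro powr_mono) auto
  thus ?thesis using powr_ge_zero[of t a] by linarith
next
  case False
  hence "t powr x \<le> t powr a" using assms by (intro powr_mono') auto
  thus ?thesis using powr_ge_zero[of t b] by linarith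
qed

context
  fixes f :: "real \<Rightarrow> complex" and C s c :: real
  assumes cont: "continuous_on {0<..} f"
    and bound: "\<And>t. t > 0 \<Longrightarrow> norm (f t) \<le> C * t powr s * exp (- (c * t))"
    and c: "c > 0"
begin

text \<open>The right-hand side depends on \<alpha> only through the strip, so it can serve as
  dominating function near a given point. Integrability at a single \<alpha> is the case where
  \<open>a\<close> and \<open>b\<close> both equal \<open>Re \<alpha>\<close>.\<close>

lemma mellin_bound:
  assumes "t > 0" "a \<le> Re \<alpha>" "Re \<alpha> \<le> b"
  shows "norm (of_real t powr (\<alpha> - 1) * f t) \<le>
           C * (t powr (a + s - 1) * exp (- (c * t)) + t powr (b + s - 1) * exp (- (c * t)))"
proof -
  have "norm (of_real t powr (\<alpha> - 1) * f t) \<le>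
          (t powr (a - 1) + t powr (b - 1)) * (C * t powr s * exp (- (c * t)))"
    unfolding norm_mult norm_of_real_powr[OF assms(1)]
    by (intro mult_mono bound assms powr_le_sum) (use assms in auto)
  also have "\<dots> = C * (t powr (a + s - 1) * exp (- (c * t)) + t powr (b + s - 1) * exp (- (c * t)))"
    using assms by (simp add: powr_add powr_diff field_simps)
  finally show ?thesis .
qed

lemma set_integrable_mellin:
  assumes "Re \<alpha> > - s"
  shows "set_integrable lborel {0<..} (\<lambda>t. of_real t powr (\<alpha> - 1) * f t)"
proof (rule set_integrable_bound)
  let ?g = "\<lambda>t. C * (t powr (Re \<alpha> + s - 1) * exp (- (c * t)) + t powr (Re \<alpha> + s - 1) * exp (- (c * t)))"
  show "set_integrable lborel {0<..} ?g"
    by (intro set_integrable_mult_right set_integral_add set_integrable_powr_exp) (use assms c in auto)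
  show "set_borel_measurable lborel {0<..} (\<lambda>t. of_real t powr (\<alpha> - 1) * f t)"
    by (intro set_borel_measurable_continuous_lborel continuous_intros cont) auto
  show "AE t in lborel. t \<in> {0<..} \<longrightarrow> norm (of_real t powr (\<alpha> - 1) * f t) \<le> norm (?g t)"
  proof (intro AE_I2 impI)
    fix t :: real assume "t \<in> {0<..}"
    with mellin_bound[of t "Re \<alpha>" \<alpha> "Re \<alpha>"]
    show "norm (of_real t powr (\<alpha> - 1) * f t) \<le> norm (?g t)" by simp
  qed
qed

lemma holomorphic_mellin: "mellin f holomorphic_on {\<alpha>. Re \<alpha> > - s}"
  unfolding mellin_def set_lebesgue_integral_def
proof (rule holomorphic_on_lebesgue_integral)
  show "open {\<alpha>. Re \<alpha> > - s}" by (rule open_halfspace_Re_gt)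
  show "(\<lambda>t. indicator {0<..} t *\<^sub>R (of_real t powr (\<alpha> - 1) * f t)) \<in> borel_measurable lborel" for \<alpha>
    unfolding set_borel_measurable_def[symmetric]
    by (intro set_borel_measurable_continuous_lborel continuous_intros cont) auto
  show "(\<lambda>\<alpha>. indicator {0<..} t *\<^sub>R (of_real t powr (\<alpha> - 1) * f t)) holomorphic_on {\<alpha>. Re \<alpha> > - s}" for t
    by (cases "t > 0") (auto intro!: holomorphic_intros)
next
  fix z assume z: "z \<in> {\<alpha>. Re \<alpha> > - s}"
  \<comment> \<open>Half the distance from \<open>z\<close> to the boundary line, so that the
    exponent \<open>Re z - e + s = e\<close> stays positive.\<close>
  define e where "e = (Re z + s) / 2"
  let ?g = "\<lambda>t. indicator {0<..} t *\<^sub>R (C * (t powr (Re z - e + s - 1) * exp (- (c * t)) +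
                                          t powr (Re z + e + s - 1) * exp (- (c * t))))"
  show "\<exists>e>0. \<exists>g. integrable lborel g \<and> (\<forall>u\<in>ball z e \<inter> {\<alpha>. Re \<alpha> > - s}. \<forall>t\<in>space lborel.
          norm (indicator {0<..} t *\<^sub>R (of_real t powr (u - 1) * f t)) \<le> g t)"
  proof (intro exI conjI ballI)
    show "e > 0" using z by (simp add: e_def)
    have "set_integrable lborel {0<..} (\<lambda>t. C * (t powr (Re z - e + s - 1) * exp (- (c * t)) +
                                          t powr (Re z + e + s - 1) * exp (- (c * t))))"
      by (intro set_integrable_mult_right set_integral_add set_integrable_powr_exp)
         (use z c in \<open>auto simp: e_def field_simps\<close>)
    thus "integrable lborel ?g" unfolding set_integrable_def .
    fix u t assume u: "u \<in> ball z e \<inter> {\<alpha>. Re \<alpha> > - s}"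
    have "\<bar>Re z - Re u\<bar> < e"
      using u abs_Re_le_cmod[of "z - u"] by (simp add: dist_norm)
    thus "norm (indicator {0<..} t *\<^sub>R (of_real t powr (u - 1) * f t)) \<le> ?g t"
      using mellin_bound[of t "Re z - e" u "Re z + e"] by (cases "t > 0") auto
  qed
qed

end

section \<open>Mellin transforms of exponentials\<close>

lemma mellin_exp_real:
  fixes c :: real
  assumes \<alpha>: "Re \<alpha> > 0" and c: "c > 0"
  shows "mellin (\<lambda>t. exp (- (of_real c * of_real t))) \<alpha> = Gamma \<alpha> * of_real c powr (- \<alpha>)"
proof -
  define g where "g = (\<lambda>t::real. indicator {0<..} t *\<^sub>R (of_real t powr (\<alpha> - 1) * exp (- complex_of_real t)))"
  have int: "set_integrable lborel {0<..} (\<lambda>t. of_real t powr (\<alpha> - 1) * exp (- complex_of_real t))"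
    by (rule set_integrable_mellin[where C = 1 and s = 0 and c = 1])
       (use \<alpha> in \<open>auto intro!: continuous_intros\<close>)
  have "((\<lambda>t. of_real t powr (\<alpha> - 1) * exp (- complex_of_real t)) has_integral Gamma \<alpha>) {0<..}"
    using Gamma_integral_complex'[OF \<alpha>] by (simp add: exp_minus exp_of_real field_simps)
  hence "Gamma \<alpha> = (LBINT t:{0<..}. of_real t powr (\<alpha> - 1) * exp (- complex_of_real t))"
    using set_borel_integral_eq_integral(2)[OF int] by (simp add: has_integral_iff)
  \<comment> \<open>Rescale \<open>t\<close> by \<open>c\<close> in Euler's integral. The Jacobian
    \<open>c\<close> and the factor \<open>c powr (\<alpha> - 1)\<close> from the integrand combine
    to \<open>c powr \<alpha>\<close>. Since \<open>g\<close> contains the indicator, the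
    substitution runs over the whole line.\<close>
  also have "\<dots> = c *\<^sub>R (LINT t|lborel. g (0 + c * t))"
    unfolding set_lebesgue_integral_def using lborel_integral_real_affine[of c g 0] c
    by (simp add: g_def)
  also have "(LINT t|lborel. g (0 + c * t)) =
      (LINT t|lborel. of_real c powr (\<alpha> - 1) *
         (indicator {0<..} t *\<^sub>R (of_real t powr (\<alpha> - 1) * exp (- (of_real c * of_real t)))))"
  proof (intro Bochner_Integration.integral_cong refl)
    fix t :: real
    show "g (0 + c * t) = of_real c powr (\<alpha> - 1) *
         (indicator {0<..} t *\<^sub>R (of_real t powr (\<alpha> - 1) * exp (- (of_real c * of_real t))))"
      using c by (cases "t > 0") (auto simp: g_def powr_times_real zero_less_mult_iff)
  qed
  also have "\<dots> = of_real c powr (\<alpha> - 1) * mellin (\<lambda>t. exp (- (of_real c * of_real t))) \<alpha>"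
    unfolding mellin_def set_lebesgue_integral_def by (rule integral_mult_right_zero)
  finally show ?thesis using c
    by (simp add: scaleR_conv_of_real powr_diff powr_minus field_simps)
qed

text \<open>Both sides are holomorphic in \<open>c\<close> on the right half-plane and agree for
  positive real \<open>c\<close>, hence everywhere there by the identity theorem.\<close>

lemma mellin_exp:
  assumes \<alpha>: "Re \<alpha> > 0" and c: "Re c > 0"
  shows "mellin (\<lambda>t. exp (- (c * of_real t))) \<alpha> = Gamma \<alpha> * c powr (- \<alpha>)"
proof -
  let ?S = "{c. Re c > 0}"
  define K where "K = (\<lambda>c t. indicator {0<..} t *\<^sub>R (of_real t powr (\<alpha> - 1) * exp (- (c * complex_of_real t))))"
  have holo: "(\<lambda>c. LINT t|lborel. K c t) holomorphic_on ?S"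
  proof (rule holomorphic_on_lebesgue_integral)
    show "K c \<in> borel_measurable lborel" for c
      using set_borel_measurable_continuous_lborel[of "{0<..}" "\<lambda>t. of_real t powr (\<alpha> - 1) * exp (- (c * complex_of_real t))"]
      by (auto simp: set_borel_measurable_def K_def intro!: continuous_intros)
    show "(\<lambda>c. K c t) holomorphic_on ?S" for t
      unfolding K_def by (auto intro!: holomorphic_intros simp: scaleR_conv_of_real)
  next
    fix c assume c: "c \<in> ?S"
    \<comment> \<open>Within distance \<open>Re c / 2\<close> of \<open>c\<close> the real part is
      at least \<open>Re c / 2\<close>, which gives a common decay rate.\<close>
    let ?g = "\<lambda>t. indicator {0<..} t *\<^sub>R (t powr (Re \<alpha> - 1) * exp (- (Re c / 2 * t)))"
    show "\<exists>e>0. \<exists>g. integrable lborel g \<and> (\<forall>u\<in>ball c e \<inter> ?S. \<forall>t\<in>space lborel. norm (K u t) \<le> g t)"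
    proof (intro exI conjI ballI)
      show "Re c / 2 > 0" using c by simp
      show "integrable lborel ?g"
        using set_integrable_powr_exp[of "Re \<alpha>" "Re c / 2"] c \<alpha> by (simp add: set_integrable_def)
      fix u t assume u: "u \<in> ball c (Re c / 2) \<inter> ?S"
      have "\<bar>Re c - Re u\<bar> < Re c / 2"
        using u abs_Re_le_cmod[of "c - u"] by (simp add: dist_norm)
      hence "Re c / 2 \<le> Re u" by linarith
      thus "norm (K u t) \<le> ?g t"
        by (cases "t > 0") (auto simp: K_def norm_mult norm_of_real_powr)
    qed
  qed (rule open_halfspace_Re_gt)
  \<comment> \<open>The identity theorem needs an accumulation point of the positive reals inside
    the half-plane; 1 is approached by \<open>1 + 1 / (n + 1)\<close>.\<close>
  have lim: "(1::complex) islimpt (of_real ` {0<..})"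
  proof -
    have "(\<lambda>n. 1 + 1 / of_nat (Suc n) :: complex) \<longlonglongrightarrow> 1 + 0"
      by (intro tendsto_intros LIMSEQ_Suc[OF lim_1_over_n])
    moreover have "1 + 1 / of_nat (Suc n) \<in> of_real ` {0<..} - {1::complex}" for n
    proof -
      have "(1 + 1 / of_nat (Suc n) :: complex) = of_real (1 + 1 / real (Suc n))" by simp
      moreover have "1 + 1 / real (Suc n) \<in> {0<..}" by (simp add: add_pos_nonneg)
      moreover have "(1 + 1 / of_nat (Suc n) :: complex) \<noteq> 1"
        using of_nat_neq_0[of n, where ?'a = complex] by (simp del: of_nat_Suc)
      ultimately show ?thesis by blast
    qed
    ultimately show ?thesis unfolding islimpt_sequential by (metis add.right_neutral)
  qed
  have "(LINT t|lborel. K c t) - Gamma \<alpha> * c powr (- \<alpha>) = 0"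
  proof (rule analytic_continuation[where f = "\<lambda>c. (LINT t|lborel. K c t) - Gamma \<alpha> * c powr (- \<alpha>)"
          and S = ?S and U = "of_real ` {0<..}"])
    show "(\<lambda>c. (LINT t|lborel. K c t) - Gamma \<alpha> * c powr (- \<alpha>)) holomorphic_on ?S"
      by (intro holomorphic_intros holo) (auto simp: complex_nonpos_Reals_iff)
    show "connected ?S" by (intro convex_connected convex_halfspace_Re_gt)
    show "(LINT t|lborel. K u t) - Gamma \<alpha> * u powr (- \<alpha>) = 0" if "u \<in> of_real ` {0<..}" for u
      using that mellin_exp_real[OF \<alpha>] by (auto simp: mellin_def set_lebesgue_integral_def K_def)
  qed (use lim c in \<open>auto simp: open_halfspace_Re_gt\<close>)
  thus ?thesis by (simp add: mellin_def set_lebesgue_integral_def K_def)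
qed

section \<open>Bounds for the kernel and its remainders\<close>

definition barnes_kernel :: "nat \<Rightarrow> (nat \<Rightarrow> complex) \<Rightarrow> real \<Rightarrow> complex" where
  "barnes_kernel d w t = 1 / (\<Prod>i=1..d. 1 - exp (- (w i * of_real t))) - 1"

text \<open>The Taylor coefficients of \<open>t ^ d * exp t * barnes_kernel d w t\<close> at 0. The
  factor \<open>exp t\<close> leads to the Bernoulli argument -1; the subtracted part is the series
  of \<open>t ^ d * exp t\<close>, which stems from the \<open>- 1\<close> in the kernel.\<close>

definition barnes_coeff :: "nat \<Rightarrow> (nat \<Rightarrow> complex) \<Rightarrow> nat \<Rightarrow> complex" where
  "barnes_coeff d w m = (-1) ^ m * bernoulli_poly_ho d w m (-1) / (fact m * (\<Prod>i=1..d. w i))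
                        - (if m \<ge> d then 1 / fact (m - d) else 0)"

text \<open>The subtracted terms keep the factor \<open>exp (- t)\<close> so that they decay at
  infinity like the kernel does and have Gamma integrals as Mellin transforms.\<close>

definition barnes_remainder :: "nat \<Rightarrow> (nat \<Rightarrow> complex) \<Rightarrow> nat \<Rightarrow> real \<Rightarrow> complex" where
  "barnes_remainder d w M t = barnes_kernel d w t
     - inverse (of_real t ^ d) * exp (- of_real t) * (\<Sum>m<M. barnes_coeff d w m * of_real t ^ m)"

lemma barnes_remainder_0: "barnes_remainder d w 0 = barnes_kernel d w"
  by (simp add: barnes_remainder_def fun_eq_iff)

lemma exp_uminus_neq_1:
  assumes "Re z > 0"
  shows "exp (- z) \<noteq> (1 :: complex)"
proof
  assume "exp (- z) = 1"
  hence "norm (exp (- z)) = 1" by simp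
  thus False using assms by simp
qed

text \<open>A single term of the exponential series bounds \<open>t ^ n * exp (- (e * t))\<close>.
  With \<open>n \<ge> p\<close> the remaining power \<open>t powr (p - n)\<close> is nonincreasing
  and so largest at \<open>r\<close>.\<close>

lemma powr_exp_bounded:
  fixes r p e :: real
  assumes "r > 0" "e > 0"
  shows "\<exists>K\<ge>0. \<forall>t\<ge>r. t powr p * exp (- (e * t)) \<le> K"
proof -
  define n where "n = nat \<lceil>p\<rceil>"
  have n: "p \<le> n" unfolding n_def by linarith
  define K where "K = r powr (p - n) * (fact n / e ^ n)"
  show ?thesis
  proof (intro exI[of _ K] conjI allI impI)
    fix t assume t: "t \<ge> r"
    have "(e * t) ^ n / fact n \<le> exp (e * t)"
    proof -
      have "(e * t) ^ n /\<^sub>R fact n \<le> (\<Sum>k<Suc n. (e * t) ^ k /\<^sub>R fact k)"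
        by (rule member_le_sum) (use assms t in auto)
      also have "\<dots> \<le> exp (e * t)"
        unfolding exp_def by (rule sum_le_suminf[OF summable_exp_generic]) (use assms t in auto)
      finally show ?thesis by (simp add: field_simps)
    qed
    hence 1: "t ^ n * exp (- (e * t)) \<le> fact n / e ^ n"
      using assms by (simp add: exp_minus field_simps power_mult_distrib)
    have "t powr p = t powr (p - n) * t ^ n"
      using t assms by (simp add: powr_diff powr_realpow)
    also have "\<dots> * exp (- (e * t)) = t powr (p - n) * (t ^ n * exp (- (e * t)))" by simp
    also have "\<dots> \<le> K"
      unfolding K_def by (intro mult_mono 1 powr_mono2') (use assms t n in auto)
    finally show "t powr p * exp (- (e * t)) \<le> K" .
  qed (use assms in \<open>auto simp: K_def\<close>)
qed

text \<open>Induction on the index set: for a new factor \<open>u\<close> and the old product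
  \<open>P\<close>, the identity \<open>u * P - 1 = (u - 1) * (P - 1) + (u - 1) + (P - 1)\<close>
  splits the error into parts that each decay.\<close>

lemma prod_exp_decay:
  fixes w :: "'i \<Rightarrow> complex" and r c :: real
  assumes "finite I" "r > 0" "c > 0" "\<And>i. i \<in> I \<Longrightarrow> Re (w i) \<ge> c"
  shows "\<exists>C\<ge>0. \<forall>t\<ge>r. norm ((\<Prod>i\<in>I. 1 / (1 - exp (- (w i * of_real t)))) - 1) \<le> C * exp (- (c * t))"
  using assms(1,4)
proof (induction I rule: finite_induct)
  case empty
  show ?case by (intro exI[of _ 0]) auto
next
  case (insert j I)
  obtain C where C: "C \<ge> 0"
    "\<And>t. t \<ge> r \<Longrightarrow> norm ((\<Prod>i\<in>I. 1 / (1 - exp (- (w i * of_real t)))) - 1) \<le> C * exp (- (c * t))"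
    using insert.IH insert.prems by blast
  \<comment> \<open>Bounds the new factor: for \<open>t \<ge> r\<close> its denominator has norm at
    least \<open>1 - exp (- (c * r)) > 0\<close>.\<close>
  define K where "K = 1 / (1 - exp (- (c * r)))"
  have K: "K \<ge> 0" using assms by (auto simp: K_def)
  have "norm ((\<Prod>i\<in>insert j I. 1 / (1 - exp (- (w i * of_real t)))) - 1) \<le> (K * C + K + C) * exp (- (c * t))"
    if t: "t \<ge> r" for t
  proof -
    define q where "q = exp (- (w j * of_real t))"
    define P where "P = (\<Prod>i\<in>I. 1 / (1 - exp (- (w i * of_real t))))"
    have tpos: "t > 0" using t assms by linarith
    have q: "norm q \<le> exp (- (c * t))"
      using insert.prems[of j] tpos by (simp add: q_def mult_right_mono)
    have "1 - exp (- (c * r)) \<le> 1 - norm q"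
      using q t assms by (smt (verit) exp_le_cancel_iff mult_left_mono)
    also have "\<dots> \<le> norm (1 - q)"
      using norm_triangle_ineq2[of 1 q] by simp
    finally have lower: "1 - exp (- (c * r)) \<le> norm (1 - q)" .
    have pos: "1 - exp (- (c * r)) > 0" using assms by simp
    have "q \<noteq> 1" using lower pos by auto
    hence "1 / (1 - q) - 1 = q / (1 - q)" by (simp add: field_simps)
    hence "norm (1 / (1 - q) - 1) = norm q / norm (1 - q)" by (simp add: norm_divide)
    also have "\<dots> \<le> exp (- (c * t)) / (1 - exp (- (c * r)))"
      by (intro frac_le q lower pos) auto
    finally have u: "norm (1 / (1 - q) - 1) \<le> K * exp (- (c * t))" by (simp add: K_def)
    have P: "norm (P - 1) \<le> C * exp (- (c * t))" unfolding P_def by (rule C(2)[OF t])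
    have e1: "exp (- (c * t)) \<le> 1" using tpos assms by simp
    have "norm (P - 1) \<le> C"
      using P e1 C(1) by (meson mult_left_le order_trans)
    hence 2: "norm ((1 / (1 - q) - 1) * (P - 1)) \<le> (K * exp (- (c * t))) * C"
      unfolding norm_mult by (intro mult_mono u) (use K in auto)
    have "u * P - 1 = (u - 1) * (P - 1) + (u - 1) + (P - 1)" for u
      by (simp add: algebra_simps)
    hence "norm (1 / (1 - q) * P - 1) \<le>
      norm ((1 / (1 - q) - 1) * (P - 1)) + norm (1 / (1 - q) - 1) + norm (P - 1)"
      by (metis add_right_mono norm_triangle_ineq norm_triangle_le)
    also have "\<dots> \<le> (K * C + K + C) * exp (- (c * t))"
      using u P 2 by (simp add: algebra_simps)
    finally show ?thesis
      using insert.hyps by (simp add: P_def q_def)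
  qed
  moreover have "K * C + K + C \<ge> 0" using K C by auto
  ultimately show ?case by blast
qed

section \<open>Expansion of the kernel at 0 and global bounds for the remainders\<close>

context
  fixes d :: nat and w :: "nat \<Rightarrow> complex"
  assumes w: "\<And>i. i \<in> {1..d} \<Longrightarrow> Re (w i) > 0"
begin

text \<open>Evaluate the Bernoulli generating function at \<open>x = -1\<close> and
  \<open>z = -t\<close>: the sign of \<open>(- t) ^ d\<close> cancels against the \<open>d\<close>
  signs from the denominators. Then subtract the series of \<open>t ^ d * exp t\<close>.\<close>

lemma barnes_kernel_sums:
  assumes t: "t > 0" "\<And>i. i \<in> {1..d} \<Longrightarrow> t < 2 * pi / norm (w i)"
  shows "(\<lambda>m. barnes_coeff d w m * of_real t ^ m) sums
           (of_real t ^ d * exp (of_real t) * barnes_kernel d w t)"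
proof -
  define P where "P = (\<Prod>i=1..d. w i)"
  define Q where "Q = (\<Prod>i=1..d. 1 - exp (- (w i * of_real t)))"
  have w0: "w i \<noteq> 0" if "i \<in> {1..d}" for i using w[OF that] by auto
  have P: "P \<noteq> 0" using w0 by (auto simp: P_def)
  have "(\<lambda>n. bernoulli_poly_ho d w n (-1) * (- of_real t) ^ n / fact n) sums
           ((- of_real t) ^ d * exp ((-1) * (- of_real t)) * (\<Prod>i=1..d. w i / (exp (w i * (- of_real t)) - 1)))"
    by (rule bernoulli_poly_ho_sums) (use w0 t in auto)
  also have "(\<Prod>i=1..d. w i / (exp (w i * (- of_real t)) - 1)) = (\<Prod>i=1..d. (-1) * (w i / (1 - exp (- (w i * of_real t)))))"
  proof (intro prod.cong refl)
    have "a / (E - 1) = (-1) * (a / (1 - E))" for a E :: complex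
      by (metis minus_diff_eq minus_divide_right mult_minus1)
    thus "w i / (exp (w i * (- of_real t)) - 1) = (-1) * (w i / (1 - exp (- (w i * of_real t))))" for i
      by simp
  qed
  also have "\<dots> = (-1) ^ d * (P / Q)"
    by (subst prod.distrib) (simp add: P_def Q_def prod_dividef)
  also have "(- complex_of_real t) ^ d * exp ((-1) * (- of_real t)) * ((-1) ^ d * (P / Q)) =
      of_real t ^ d * exp (of_real t) * (P / Q)"
    by (subst power_minus) (simp add: algebra_simps flip: power_add mult_2)
  finally have "(\<lambda>n. inverse P * (bernoulli_poly_ho d w n (-1) * (- of_real t) ^ n / fact n)) sums
     (inverse P * (of_real t ^ d * exp (of_real t) * (P / Q)))"
    by (rule sums_mult)
  hence 1: "(\<lambda>n. (-1) ^ n * bernoulli_poly_ho d w n (-1) / (fact n * P) * of_real t ^ n) sums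
     (of_real t ^ d * exp (of_real t) / Q)"
    using P by (subst (asm) power_minus) (simp add: field_simps)
  have "(\<lambda>n. of_real t ^ d * (of_real t ^ n /\<^sub>R fact n)) sums (of_real t ^ d * exp (complex_of_real t))"
    by (intro sums_mult exp_converges)
  hence "(\<lambda>n. (if n + d \<ge> d then 1 / fact (n + d - d) else 0) * of_real t ^ (n + d)) sums
     (of_real t ^ d * exp (complex_of_real t))"
    by (simp add: scaleR_conv_of_real power_add field_simps)
  \<comment> \<open>Undoing the index shift adds the first \<open>d\<close> terms, all of which are
    0 by the conditional.\<close>
  hence 2: "(\<lambda>n. (if n \<ge> d then 1 / fact (n - d) else 0) * of_real t ^ n) sums
     (of_real t ^ d * exp (complex_of_real t))"
    by (subst (asm) sums_iff_shift) simp
  have "(\<lambda>m. barnes_coeff d w m * of_real t ^ m) sums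
     (of_real t ^ d * exp (of_real t) / Q - of_real t ^ d * exp (complex_of_real t))"
    using sums_diff[OF 1 2] by (simp add: barnes_coeff_def P_def algebra_simps)
  thus ?thesis by (simp add: barnes_kernel_def Q_def algebra_simps)
qed

text \<open>Up to the bounded factor \<open>exp (- t)\<close>, the remainder is
  \<open>t powr (M - d)\<close> times the tail power series \<open>h\<close>, and \<open>h\<close>
  is bounded on a compact disc by continuity.\<close>

lemma barnes_remainder_near_0:
  "\<exists>r>0. \<exists>C\<ge>0. \<forall>t. 0 < t \<longrightarrow> t \<le> r \<longrightarrow>
     norm (barnes_remainder d w M t) \<le> C * t powr (real M - real d)"
proof -
  \<comment> \<open>A radius within which the Bernoulli expansion is valid; the inserted 1 keeps the
    set nonempty. Convergence at \<open>R/2\<close> gives continuity inside that radius, in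
    particular on the closed disc of radius \<open>R/4\<close>.\<close>
  define R where "R = Min (insert 1 ((\<lambda>i. 2 * pi / norm (w i)) ` {1..d}))"
  have w0: "w i \<noteq> 0" if "i \<in> {1..d}" for i using w[OF that] by auto
  have R: "R > 0" unfolding R_def using w0 by (subst Min_gr_iff) auto
  have sums: "(\<lambda>m. barnes_coeff d w m * of_real t ^ m) sums
           (of_real t ^ d * exp (of_real t) * barnes_kernel d w t)" if "t > 0" "t < R" for t
    by (rule barnes_kernel_sums) (use that in \<open>auto simp: R_def\<close>)
  define c where "c = (\<lambda>m. barnes_coeff d w (m + M))"
  have sm: "summable (\<lambda>m. c m * of_real (R/2) ^ m)"
  proof -
    have "summable (\<lambda>m. barnes_coeff d w (m + M) * of_real (R/2) ^ (m + M))"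
      using sums[of "R/2"] R by (intro summable_ignore_initial_segment) (auto simp: sums_iff)
    hence "summable (\<lambda>m. c m * of_real (R/2) ^ m * of_real (R/2) ^ M)"
      by (simp add: c_def power_add mult_ac)
    hence "summable (\<lambda>m. c m * of_real (R/2) ^ m * of_real (R/2) ^ M / of_real (R/2) ^ M)"
      by (rule summable_divide)
    thus ?thesis using R by simp
  qed
  define h where "h = (\<lambda>z. \<Sum>m. c m * z ^ m)"
  have "isCont h z" if "norm z \<le> R/4" for z
    unfolding h_def by (rule isCont_powser[OF sm]) (use that R in auto)
  hence "continuous_on (cball 0 (R/4)) h"
    by (intro continuous_at_imp_continuous_on) auto
  hence "compact (h ` cball 0 (R/4))" by (intro compact_continuous_image) auto
  then obtain B where B: "B > 0" "\<And>z. z \<in> cball 0 (R/4) \<Longrightarrow> norm (h z) \<le> B"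
    using compact_imp_bounded[of "h ` cball 0 (R/4)"] unfolding bounded_pos by auto
  have "norm (barnes_remainder d w M t) \<le> B * t powr (real M - real d)" if t: "t > 0" "t \<le> R/4" for t
  proof -
    define T where "T = complex_of_real t"
    have T0: "T \<noteq> 0" using t by (simp add: T_def)
    have "of_real t ^ d * exp (of_real t) * barnes_kernel d w t =
       (\<Sum>m. barnes_coeff d w (m + M) * T ^ (m + M)) + (\<Sum>m<M. barnes_coeff d w m * T ^ m)"
      using suminf_split_initial_segment[of "\<lambda>m. barnes_coeff d w m * T ^ m" M] sums[of t] R t
      by (auto simp: sums_iff T_def)
    also have "(\<Sum>m. barnes_coeff d w (m + M) * T ^ (m + M)) = T ^ M * h T"
    proof -
      have "summable (\<lambda>m. c m * T ^ m)"
        by (rule powser_inside[OF sm]) (use t R in \<open>auto simp: T_def\<close>)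
      thus ?thesis by (simp add: h_def c_def power_add mult_ac flip: suminf_mult)
    qed
    finally have "T ^ d * exp T * barnes_kernel d w t - (\<Sum>m<M. barnes_coeff d w m * T ^ m) = T ^ M * h T"
      by (simp add: T_def)
    hence "inverse (T ^ d) * exp (- T) * (T ^ d * exp T * barnes_kernel d w t - (\<Sum>m<M. barnes_coeff d w m * T ^ m))
         = inverse (T ^ d) * exp (- T) * (T ^ M * h T)" by simp
    also have "inverse (T ^ d) * exp (- T) * (T ^ d * exp T * barnes_kernel d w t - (\<Sum>m<M. barnes_coeff d w m * T ^ m)) =
         barnes_remainder d w M t"
      using T0 by (simp add: barnes_remainder_def T_def exp_minus field_simps)
    finally have "norm (barnes_remainder d w M t) = inverse (t ^ d) * exp (- t) * (t ^ M * norm (h T))"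
      using t by (simp add: norm_mult norm_inverse norm_power T_def)
    also have "\<dots> \<le> inverse (t ^ d) * 1 * (t ^ M * B)"
      by (intro mult_mono B) (use t in \<open>auto simp: T_def\<close>)
    also have "\<dots> = B * t powr (real M - real d)"
      using t by (simp add: powr_diff powr_realpow field_simps)
    finally show ?thesis .
  qed
  thus ?thesis using B(1) R by (intro exI[of _ "R/4"] conjI exI[of _ B]) auto
qed

text \<open>Supplies the hypothesis of the general Mellin lemmas with \<open>s = M - d\<close>. For
  small \<open>t\<close> it comes from the expansion at 0; for large \<open>t\<close> kernel and
  subtracted terms decay exponentially, and half of the decay rate is spent on converting powers of
  \<open>t\<close>.\<close>

lemma barnes_remainder_bound:
  "\<exists>c>0. \<exists>C. \<forall>t>0. norm (barnes_remainder d w M t) \<le> C * t powr (real M - real d) * exp (- (c * t))"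
proof -
  obtain r C1 where r: "r > 0" "C1 \<ge> 0" and
    near: "\<And>t. 0 < t \<Longrightarrow> t \<le> r \<Longrightarrow> norm (barnes_remainder d w M t) \<le> C1 * t powr (real M - real d)"
    using barnes_remainder_near_0 by blast
  \<comment> \<open>A common decay rate: the kernel decays at the smallest \<open>Re (w i)\<close>
    or faster, the subtracted terms at rate 1.\<close>
  define a where "a = Min (insert 1 ((\<lambda>i. Re (w i)) ` {1..d}))"
  have a: "a > 0" unfolding a_def using w by (subst Min_gr_iff) auto
  have a_le: "a \<le> 1" "\<And>i. i \<in> {1..d} \<Longrightarrow> a \<le> Re (w i)"
    unfolding a_def by (intro Min_le; auto)+
  define c where "c = a / 2"
  have c: "c > 0" using a by (simp add: c_def)
  define p where "p = real M - real d"
  obtain C2 where C2: "C2 \<ge> 0" "\<And>t. t \<ge> r \<Longrightarrow> norm (barnes_kernel d w t) \<le> C2 * exp (- (a * t))"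
    using prod_exp_decay[of "{1..d}" r a w] r(1) a a_le(2)
    by (auto simp: barnes_kernel_def prod_dividef)
  obtain K where K: "\<And>q. K q \<ge> 0" "\<And>q t. t \<ge> r \<Longrightarrow> t powr q * exp (- (c * t)) \<le> K q"
    using powr_exp_bounded[OF r(1) c] by metis
  have step: "t powr q * exp (- (a * t)) \<le> K (q - p) * (t powr p * exp (- (c * t)))" if "t \<ge> r" for q t
  proof -
    have "exp (- (a * t)) = exp (- (c * t)) * exp (- (c * t))"
      by (simp add: c_def flip: exp_add)
    hence "t powr q * exp (- (a * t)) = (t powr (q - p) * exp (- (c * t))) * (t powr p * exp (- (c * t)))"
      using that r by (simp add: powr_diff)
    also have "\<dots> \<le> K (q - p) * (t powr p * exp (- (c * t)))"
      by (intro mult_right_mono K that) auto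
    finally show ?thesis .
  qed
  define C3 where "C3 = C2 * K (0 - p) + (\<Sum>m<M. norm (barnes_coeff d w m) * K (real m - real d - p))"
  have far: "norm (barnes_remainder d w M t) \<le> C3 * (t powr p * exp (- (c * t)))" if t: "t \<ge> r" for t
  proof -
    have t0: "t > 0" using t r by linarith
    have eq: "barnes_remainder d w M t = barnes_kernel d w t - 
       (\<Sum>m<M. barnes_coeff d w m * (inverse (of_real t ^ d) * of_real t ^ m * exp (- of_real t)))"
      unfolding barnes_remainder_def sum_distrib_left by (intro arg_cong2[where f = "(-)"] refl sum.cong) simp
    have "norm (barnes_remainder d w M t) \<le> norm (barnes_kernel d w t) + 
       (\<Sum>m<M. norm (barnes_coeff d w m * (inverse (of_real t ^ d) * of_real t ^ m * exp (- of_real t))))"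
      unfolding eq by (rule order_trans[OF norm_triangle_ineq4]) (intro add_left_mono norm_sum)
    also have "\<dots> \<le> C2 * (K (0 - p) * (t powr p * exp (- (c * t)))) +
       (\<Sum>m<M. norm (barnes_coeff d w m) * (K (real m - real d - p) * (t powr p * exp (- (c * t)))))"
    proof (intro add_mono sum_mono)
      have "norm (barnes_kernel d w t) \<le> C2 * (t powr 0 * exp (- (a * t)))"
        using C2(2)[OF t] t0 by simp
      also have "\<dots> \<le> C2 * (K (0 - p) * (t powr p * exp (- (c * t))))"
        by (intro mult_left_mono step t C2)
      finally show "norm (barnes_kernel d w t) \<le> C2 * (K (0 - p) * (t powr p * exp (- (c * t))))" .
    next
      fix m
      have "norm (inverse (of_real t ^ d) * of_real t ^ m * exp (- complex_of_real t)) =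
          t powr (real m - real d) * exp (- (1 * t))"
        using t0 by (simp add: norm_mult norm_divide norm_inverse norm_power powr_diff powr_realpow field_simps)
      also have "\<dots> \<le> t powr (real m - real d) * exp (- (a * t))"
        using a_le t0 by (intro mult_left_mono) auto
      also have "\<dots> \<le> K (real m - real d - p) * (t powr p * exp (- (c * t)))"
        by (rule step[OF t])
      finally show "norm (barnes_coeff d w m * (inverse (of_real t ^ d) * of_real t ^ m * exp (- of_real t)))
          \<le> norm (barnes_coeff d w m) * (K (real m - real d - p) * (t powr p * exp (- (c * t))))"
        unfolding norm_mult[of "barnes_coeff d w m"] by (intro mult_left_mono) auto
    qed
    also have "\<dots> = C3 * (t powr p * exp (- (c * t)))"
      by (simp add: C3_def distrib_right sum_distrib_right mult.assoc)
    finally show ?thesis .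
  qed
  \<comment> \<open>For \<open>t < r\<close> the factor \<open>exp (c * r)\<close> compensates for
    inserting \<open>exp (- (c * t))\<close> into the bound near 0.\<close>
  define C where "C = max C3 (C1 * exp (c * r))"
  have "norm (barnes_remainder d w M t) \<le> C * t powr p * exp (- (c * t))" if t: "t > 0" for t
  proof (cases "t \<ge> r")
    case True
    have "norm (barnes_remainder d w M t) \<le> C3 * (t powr p * exp (- (c * t)))" by (rule far[OF True])
    also have "\<dots> \<le> C * (t powr p * exp (- (c * t)))"
      by (intro mult_right_mono) (auto simp: C_def)
    finally show ?thesis by simp
  next
    case False
    have "norm (barnes_remainder d w M t) \<le> C1 * t powr p"
      using near[of t] False t by (simp add: p_def)
    also have "\<dots> = C1 * exp (c * t) * (t powr p * exp (- (c * t)))" by (simp flip: exp_add)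
    also have "\<dots> \<le> C * (t powr p * exp (- (c * t)))"
    proof (intro mult_right_mono)
      have "C1 * exp (c * t) \<le> C1 * exp (c * r)"
        using False c r(2) by (intro mult_left_mono) auto
      thus "C1 * exp (c * t) \<le> C" by (simp add: C_def)
    qed auto
    finally show ?thesis by simp
  qed
  thus ?thesis using c unfolding p_def by blast
qed

lemma continuous_on_barnes_remainder: "continuous_on {0<..} (barnes_remainder d w M)"
proof -
  have "exp (- (w i * of_real t)) \<noteq> 1" if "i \<in> {1..d}" "t > 0" for i t
    using exp_uminus_neq_1[of "w i * of_real t"] w[OF that(1)] that(2) by simp
  thus ?thesis
    unfolding barnes_remainder_def barnes_kernel_def by (intro continuous_intros) auto
qed

lemma set_integrable_mellin_barnes_remainder:
  assumes "Re \<alpha> > real d - real M"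
  shows "set_integrable lborel {0<..} (\<lambda>t. of_real t powr (\<alpha> - 1) * barnes_remainder d w M t)"
proof -
  obtain c C where "c > 0"
    "\<And>t. t > 0 \<Longrightarrow> norm (barnes_remainder d w M t) \<le> C * t powr (real M - real d) * exp (- (c * t))"
    using barnes_remainder_bound[of M] by blast
  thus ?thesis
    using set_integrable_mellin[OF continuous_on_barnes_remainder[of M], of C "real M - real d" c] assms by simp
qed

end

section \<open>The series as a Mellin transform\<close>

lemma geometric_infsetsum:
  fixes q :: "'a :: {real_normed_field, banach, second_countable_topology}"
  assumes "norm q < 1"
  shows "Infinite_Set_Sum.abs_summable_on (\<lambda>k. q ^ k) UNIV" "infsetsum (\<lambda>k. q ^ k) UNIV = 1 / (1 - q)"
proof -
  show *: "Infinite_Set_Sum.abs_summable_on (\<lambda>k. q ^ k) UNIV"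
    unfolding abs_summable_on_nat_iff' using assms by (simp add: norm_power summable_geometric)
  show "infsetsum (\<lambda>k. q ^ k) UNIV = 1 / (1 - q)"
    using infsetsum_nat'[OF *] suminf_geometric[OF assms] by simp
qed

context
  fixes d :: nat and w :: "nat \<Rightarrow> complex" and A :: "(nat \<Rightarrow> nat) set" and nw :: "(nat \<Rightarrow> nat) \<Rightarrow> complex"
  assumes w: "\<And>i. i \<in> {1..d} \<Longrightarrow> Re (w i) > 0"
  defines "A \<equiv> ({1..d} \<rightarrow>\<^sub>E (UNIV :: nat set)) - {\<lambda>i\<in>{1..d}. 0}"
  defines "nw \<equiv> (\<lambda>n. \<Sum>i=1..d. of_nat (n i) * w i)"
begin

lemma Re_multiindex_dot_pos:
  assumes "n \<in> A"
  shows "Re (nw n) > 0"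
proof -
  have "\<exists>i\<in>{1..d}. n i \<noteq> 0"
  proof (rule ccontr)
    assume "\<not> (\<exists>i\<in>{1..d}. n i \<noteq> 0)"
    hence "n = (\<lambda>i\<in>{1..d}. 0)"
      using assms by (intro extensionalityI[of n "{1..d}"]) (auto simp: A_def PiE_def)
    thus False using assms by (simp add: A_def)
  qed
  then obtain j where j: "j \<in> {1..d}" "n j \<noteq> 0" by blast
  have "0 < real (n j) * Re (w j)" using j w by auto
  also have "\<dots> \<le> (\<Sum>i=1..d. real (n i) * Re (w i))"
    by (rule member_le_sum) (use j less_imp_le[OF w] in auto)
  also have "\<dots> = Re (nw n)" by (simp add: nw_def)
  finally show ?thesis .
qed

text \<open>Each term factors as the product of the \<open>q i ^ n i\<close>, so the sum over all
  multi-indices is a product of geometric series; leaving out the multi-index 0 subtracts 1.\<close>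

lemma barnes_kernel_infsetsum:
  assumes t: "t > 0"
  shows "Infinite_Set_Sum.abs_summable_on (\<lambda>n. exp (- (nw n * of_real t))) A"
    and "infsetsum (\<lambda>n. exp (- (nw n * of_real t))) A = barnes_kernel d w t"
proof -
  define q where "q = (\<lambda>i. exp (- (w i * of_real t)))"
  let ?B = "{1..d} \<rightarrow>\<^sub>E (UNIV :: nat set)"
  have q: "norm (q i) < 1" if "i \<in> {1..d}" for i
    using w[OF that] t by (simp add: q_def)
  have eq: "exp (- (nw n * of_real t)) = (\<Prod>i=1..d. q i ^ n i)" for n
  proof -
    have "- (nw n * of_real t) = (\<Sum>i=1..d. of_nat (n i) * (- (w i * of_real t)))"
      by (simp add: nw_def sum_distrib_right sum_negf mult.assoc)
    thus ?thesis by (simp only: exp_sum finite_atLeastAtMost exp_of_nat_mult q_def)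
  qed
  have *: "Infinite_Set_Sum.abs_summable_on (\<lambda>n. exp (- (nw n * of_real t))) ?B"
    unfolding eq by (rule abs_summable_on_prod_PiE) (use q geometric_infsetsum in auto)
  show "Infinite_Set_Sum.abs_summable_on (\<lambda>n. exp (- (nw n * of_real t))) A"
    by (rule abs_summable_on_subset[OF *]) (auto simp: A_def)
  have "infsetsum (\<lambda>n. exp (- (nw n * of_real t))) A = 
        infsetsum (\<lambda>n. exp (- (nw n * of_real t))) ?B - infsetsum (\<lambda>n. exp (- (nw n * of_real t))) {\<lambda>i\<in>{1..d}. 0}"
    unfolding A_def by (rule infsetsum_Diff[OF *]) auto
  also have "infsetsum (\<lambda>n. exp (- (nw n * of_real t))) ?B = (\<Prod>i=1..d. infsetsum (\<lambda>k. q i ^ k) UNIV)"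
    unfolding eq by (rule infsetsum_prod_PiE) (use q geometric_infsetsum in auto)
  also have "\<dots> = (\<Prod>i=1..d. 1 / (1 - q i))"
    by (intro prod.cong refl geometric_infsetsum(2) q)
  finally show "infsetsum (\<lambda>n. exp (- (nw n * of_real t))) A = barnes_kernel d w t"
    by (simp add: barnes_kernel_def q_def nw_def prod_dividef)
qed

end

text \<open>Write the kernel as the sum of exponentials over the nonzero multi-indices and exchange
  sum and integral by Fubini; each exponential then contributes a Gamma integral.\<close>

lemma barnes_series_h_eq_mellin:
  assumes w: "\<And>i. i \<in> {1..d} \<Longrightarrow> Re (w i) > 0" and \<alpha>: "Re \<alpha> > real d"
  shows "barnes_series_h d w \<alpha> = rGamma \<alpha> * mellin (barnes_kernel d w) \<alpha>"
proof -
  define A where "A = ({1..d} \<rightarrow>\<^sub>E (UNIV :: nat set)) - {\<lambda>i\<in>{1..d}. 0}"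
  define nw where "nw = (\<lambda>n. \<Sum>i=1..d. of_nat (n i) * w i)"
  define F where "F = (\<lambda>t n. indicator {0<..} t *\<^sub>R (of_real t powr (\<alpha> - 1) * exp (- (nw n * complex_of_real t))))"
  have cA: "countable A" unfolding A_def by (intro countable_Diff countable_PiE) auto
  interpret pair_sigma_finite lborel "count_space A"
    by (intro pair_sigma_finite.intro sigma_finite_measure_count_space_countable cA)
       (rule lborel.sigma_finite_measure_axioms)
  have pos: "Re (nw n) > 0" if "n \<in> A" for n
    using that w unfolding A_def nw_def by (intro Re_multiindex_dot_pos) auto
  have ker: "Infinite_Set_Sum.abs_summable_on (\<lambda>n. exp (- (nw n * of_real t))) A"
      "infsetsum (\<lambda>n. exp (- (nw n * of_real t))) A = barnes_kernel d w t" if "t > 0" for t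
    using that w unfolding A_def nw_def by (intro barnes_kernel_infsetsum; simp)+
  have Re_\<alpha>: "Re \<alpha> > 0" using \<alpha> by (rule le_less_trans[rotated]) simp
  have Fm: "(\<lambda>t. F t n) \<in> borel_measurable lborel" for n
    unfolding F_def set_borel_measurable_def[symmetric]
    by (intro set_borel_measurable_continuous_lborel continuous_intros) auto
  have meas: "case_prod F \<in> borel_measurable (lborel \<Otimes>\<^sub>M count_space A)"
  proof (subst measurable_pair_swap_iff)
    show "(\<lambda>(x, y). case_prod F (y, x)) \<in> borel_measurable (count_space A \<Otimes>\<^sub>M lborel)"
      by (rule measurable_pair_measure_countable1[OF cA]) (use Fm in simp)
  qed
  have F1: "integrable (count_space A) (F t)" "(\<integral>n. F t n \<partial>count_space A) =
      indicator {0<..} t *\<^sub>R (of_real t powr (\<alpha> - 1) * barnes_kernel d w t)" for t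
  proof -
    show "integrable (count_space A) (F t)"
      using ker(1)[of t] by (cases "t > 0") (auto simp: F_def abs_summable_on_def)
    show "(\<integral>n. F t n \<partial>count_space A) =
      indicator {0<..} t *\<^sub>R (of_real t powr (\<alpha> - 1) * barnes_kernel d w t)"
      using ker(2)[of t] by (cases "t > 0") (auto simp: F_def infsetsum_def)
  qed
  \<comment> \<open>Taking norms replaces each \<open>w i\<close> by its real part. The sum of the
    norms is therefore governed by a kernel of the same kind, and its integrability is the remainder
    bound with no terms subtracted.\<close>
  have F2: "(\<integral>n. norm (F t n) \<partial>count_space A) =
     norm (indicator {0<..} t *\<^sub>R (of_real t powr (\<alpha> - 1) * barnes_kernel d (\<lambda>i. of_real (Re (w i))) t))" for t
  proof (cases "t > 0")
    case True
    have "(\<Sum>i=1..d. of_nat (n i) * of_real (Re (w i))) = complex_of_real (Re (nw n))" for n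
      by (simp add: nw_def)
    hence "infsetsum (\<lambda>n. exp (- (of_real (Re (nw n)) * of_real t))) A = 
      barnes_kernel d (\<lambda>i. of_real (Re (w i))) t"
      using barnes_kernel_infsetsum(2)[of d "\<lambda>i. of_real (Re (w i))" t] w True
      by (simp add: A_def)
    also have "(\<lambda>n. exp (- (of_real (Re (nw n)) * of_real t))) = (\<lambda>n. complex_of_real (norm (exp (- (nw n * of_real t)))))"
      by (simp flip: exp_of_real)
    finally have "complex_of_real (\<integral>n. norm (exp (- (nw n * of_real t))) \<partial>count_space A) =
      barnes_kernel d (\<lambda>i. of_real (Re (w i))) t"
      unfolding infsetsum_def integral_complex_of_real .
    hence *: "norm (barnes_kernel d (\<lambda>i. of_real (Re (w i))) t) = \<bar>\<integral>n. norm (exp (- (nw n * of_real t))) \<partial>count_space A\<bar>"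
      by (metis norm_of_real real_norm_def)
    have "(\<integral>n. norm (exp (- (nw n * of_real t))) \<partial>count_space A) \<ge> 0"
      by (intro Bochner_Integration.integral_nonneg) auto
    with * have "norm (barnes_kernel d (\<lambda>i. of_real (Re (w i))) t) = (\<integral>n. norm (exp (- (nw n * of_real t))) \<partial>count_space A)"
      by simp
    thus ?thesis using True by (simp add: F_def norm_mult del: norm_exp_eq_Re)
  qed (simp add: F_def)
  have int: "integrable (lborel \<Otimes>\<^sub>M count_space A) (case_prod F)"
  proof (rule Fubini_integrable[OF meas])
    show "integrable lborel (\<lambda>t. \<integral>n. norm (case_prod F (t, n)) \<partial>count_space A)"
      unfolding prod.case F2 set_integrable_def[symmetric]
      using set_integrable_mellin_barnes_remainder[of d "\<lambda>i. of_real (Re (w i))" 0 \<alpha>] w \<alpha>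
      unfolding set_integrable_def barnes_remainder_0 by (intro integrable_norm) simp
    show "AE t in lborel. integrable (count_space A) (\<lambda>n. case_prod F (t, n))"
      using F1(1) by simp
  qed
  have I: "(\<integral>t. F t n \<partial>lborel) = Gamma \<alpha> * nw n powr (- \<alpha>)" if "n \<in> A" for n
    using mellin_exp[OF Re_\<alpha> pos[OF that]] by (simp add: F_def mellin_def set_lebesgue_integral_def)
  have "Gamma \<alpha> \<noteq> 0" using Re_\<alpha> by (auto simp: Gamma_eq_zero_iff elim!: nonpos_Ints_cases)
  hence rG: "rGamma \<alpha> * Gamma \<alpha> = 1" by (simp add: rGamma_inverse_Gamma)
  \<comment> \<open>Fubini also makes the integrals of the terms summable over \<open>n\<close>;
    absolute convergence identifies the \<open>infsum\<close> of the definition with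
    \<open>infsetsum\<close>.\<close>
  have sm: "Infinite_Set_Sum.abs_summable_on (\<lambda>n. nw n powr (- \<alpha>)) A"
  proof -
    have "Infinite_Set_Sum.abs_summable_on (\<lambda>n. rGamma \<alpha> * (\<integral>t. F t n \<partial>lborel)) A"
      using integrable_snd[OF int] by (intro abs_summable_on_cmult_right) (simp add: abs_summable_on_def)
    also have "?this \<longleftrightarrow> ?thesis"
      by (intro abs_summable_on_cong refl) (simp add: I rG flip: mult.assoc)
    finally show ?thesis .
  qed
  have "barnes_series_h d w \<alpha> = infsetsum (\<lambda>n. nw n powr (- \<alpha>)) A"
    using infsetsum_infsum[OF sm] by (simp add: barnes_series_h_def A_def nw_def)
  also have "\<dots> = infsetsum (\<lambda>n. rGamma \<alpha> * (\<integral>t. F t n \<partial>lborel)) A"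
    by (intro infsetsum_cong refl) (simp add: I rG flip: mult.assoc)
  also have "\<dots> = rGamma \<alpha> * (\<integral>n. (\<integral>t. F t n \<partial>lborel) \<partial>count_space A)"
    by (simp add: infsetsum_def)
  also have "(\<integral>n. (\<integral>t. F t n \<partial>lborel) \<partial>count_space A) = (\<integral>t. (\<integral>n. F t n \<partial>count_space A) \<partial>lborel)"
    by (rule Fubini_integral[OF int])
  also have "\<dots> = mellin (barnes_kernel d w) \<alpha>"
    unfolding F1(2) by (simp add: mellin_def set_lebesgue_integral_def)
  finally show ?thesis .
qed

section \<open>Continuation and derivative at 0\<close>

lemma alternating_binomial_sum_Suc:
  fixes f :: "nat \<Rightarrow> 'a :: comm_ring_1"
  shows "(\<Sum>j\<le>Suc k. (-1) ^ j * of_nat (Suc k choose j) * f j) =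
         (\<Sum>j\<le>k. (-1) ^ j * of_nat (k choose j) * (f j - f (Suc j)))"
proof -
  have "(\<Sum>j\<le>k. (-1) ^ j * of_nat (k choose j) * f j) = (\<Sum>j\<le>Suc k. (-1) ^ j * of_nat (k choose j) * f j)"
    by (simp add: binomial_eq_0)
  also have "\<dots> = f 0 - (\<Sum>j\<le>k. (-1) ^ j * of_nat (k choose Suc j) * f (Suc j))"
    by (subst sum.atMost_Suc_shift) (simp add: sum_negf)
  finally have 1: "(\<Sum>j\<le>k. (-1) ^ j * of_nat (k choose j) * f j) =
     f 0 - (\<Sum>j\<le>k. (-1) ^ j * of_nat (k choose Suc j) * f (Suc j))" .
  \<comment> \<open>Pascal's rule, after splitting off \<open>j = 0\<close>; the first two parts
    recombine by 1 to the alternating sum of order \<open>k\<close>.\<close>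
  have "(\<Sum>j\<le>Suc k. (-1) ^ j * of_nat (Suc k choose j) * f j) =
     f 0 - (\<Sum>j\<le>k. (-1) ^ j * of_nat (k choose Suc j) * f (Suc j)) -
           (\<Sum>j\<le>k. (-1) ^ j * of_nat (k choose j) * f (Suc j))"
    by (subst sum.atMost_Suc_shift) (simp add: sum_negf algebra_simps sum.distrib sum_subtractf)
  thus ?thesis
    by (simp add: 1 [symmetric] right_diff_distrib sum_subtractf)
qed

text \<open>Passing to differences turns \<open>harm\<close> into \<open>- 1 / (j + 1)\<close>. The
  absorption identity for binomials moves this factor out as \<open>1 / n\<close>, leaving an
  alternating row sum.\<close>

lemma alternating_binomial_sum_harm:
  assumes "n > 0"
  shows "(\<Sum>j\<le>n. (-1) ^ j * of_nat (n choose j) * harm j) = - inverse (of_nat n :: 'a :: real_normed_field)"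
proof -
  obtain k where n: "n = Suc k" using assms by (cases n) auto
  have "(\<Sum>j\<le>n. (-1) ^ j * of_nat (n choose j) * harm j) =
        (\<Sum>j\<le>k. (-1) ^ j * of_nat (k choose j) * (harm j - harm (Suc j) :: 'a))"
    unfolding n by (rule alternating_binomial_sum_Suc)
  also have "\<dots> = (\<Sum>j\<le>k. inverse (of_nat n) * ((-1) ^ Suc j * of_nat (n choose Suc j)))"
  proof (intro sum.cong refl)
    fix j
    have "of_nat (Suc j) * of_nat (n choose Suc j) = (of_nat n * of_nat (k choose j) :: 'a)"
      unfolding n of_nat_mult[symmetric] by (simp only: Suc_times_binomial_eq mult.commute)
    hence "of_nat (k choose j) * inverse (of_nat (Suc j)) = inverse (of_nat n) * (of_nat (n choose Suc j) :: 'a)"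
      using assms by (simp add: field_simps del: of_nat_Suc)
    thus "(-1) ^ j * of_nat (k choose j) * (harm j - harm (Suc j) :: 'a) =
          inverse (of_nat n) * ((-1) ^ Suc j * of_nat (n choose Suc j))"
      by (simp add: harm_Suc mult.assoc del: of_nat_Suc binomial_Suc_Suc)
  qed
  \<comment> \<open>The shifted sum lacks the term \<open>j = 0\<close> of the full row, which is 1;
    the full row sums to 0.\<close>
  also have "\<dots> = inverse (of_nat n) * ((\<Sum>j\<le>n. (-1) ^ j * of_nat (n choose j)) - 1)"
    unfolding n sum.atMost_Suc_shift sum_distrib_left[symmetric] by simp
  also have "(\<Sum>j\<le>n. (-1) ^ j * of_nat (n choose j) :: 'a) = 0"
    using choose_alternating_sum[OF assms] by simp
  finally show ?thesis by simp
qed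

text \<open>The Cauchy product of the generating function at 0 with the exponential series.\<close>

lemma bernoulli_poly_ho_conv_num:
  "bernoulli_poly_ho d w m x / fact m =
     (\<Sum>l\<le>m. bernoulli_num_ho d w l / fact l * (x ^ (m - l) / fact (m - l)))"
proof -
  define P :: "complex fps" where "P = (\<Prod>i=1..d. fps_X * fps_const (w i) / (fps_exp (w i) - 1))"
  have "bernoulli_poly_ho d w m x / fact m = fps_nth (P * fps_exp x) m"
    by (simp add: bernoulli_poly_ho_def P_def mult.commute)
  also have "\<dots> = (\<Sum>l\<le>m. fps_nth P l * (x ^ (m - l) / fact (m - l)))"
    by (simp add: fps_mult_nth atLeast0AtMost)
  also have "\<dots> = (\<Sum>l\<le>m. bernoulli_num_ho d w l / fact l * (x ^ (m - l) / fact (m - l)))"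
    by (simp add: bernoulli_num_ho_def bernoulli_poly_ho_def P_def)
  finally show ?thesis .
qed

text \<open>Expand \<open>B_m(-1)\<close> in Bernoulli numbers and exchange the sums. With
  \<open>j = d - m\<close> and \<open>n = d - l\<close>, the inner sum is the alternating harmonic
  sum divided by \<open>fact n\<close>.\<close>

lemma sum_bernoulli_poly_ho_harm:
  "(\<Sum>m<d. (-1) ^ m * bernoulli_poly_ho d w m (-1) / fact m * ((-1) ^ (d - m) / fact (d - m) * harm (d - m))) =
   (\<Sum>l<d. (-1) ^ (l + 1) * bernoulli_num_ho d w l / (fact l * fact (d - l) * of_nat (d - l)))"
proof -
  define b where "b = (\<lambda>l. (-1) ^ l * bernoulli_num_ho d w l / fact l)"
  define a where "a = (\<lambda>j. (-1) ^ j / fact j * harm j :: complex)"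
  \<comment> \<open>The signs \<open>(-1) ^ m\<close> and \<open>(-1) ^ (m - l)\<close> leave
    \<open>(-1) ^ l\<close>, which is part of \<open>b l\<close>.\<close>
  have B: "(-1) ^ m * bernoulli_poly_ho d w m (-1) / fact m = (\<Sum>l\<le>m. b l / fact (m - l))" for m
  proof -
    have "(-1) ^ m * bernoulli_poly_ho d w m (-1) / fact m =
            (\<Sum>l\<le>m. (-1) ^ m * (bernoulli_num_ho d w l / fact l * ((-1) ^ (m - l) / fact (m - l))))"
      by (simp only: bernoulli_poly_ho_conv_num sum_distrib_left times_divide_eq_right [symmetric])
    also have "\<dots> = (\<Sum>l\<le>m. b l / fact (m - l))"
    proof (intro sum.cong refl)
      fix l assume "l \<in> {..m}"
      then obtain k where "m = l + k" by (auto simp: le_iff_add)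
      thus "(-1) ^ m * (bernoulli_num_ho d w l / fact l * ((-1) ^ (m - l) / fact (m - l))) = b l / fact (m - l)"
        by (cases "even k") (auto simp: b_def power_add)
    qed
    finally show ?thesis .
  qed
  have inner: "(\<Sum>m\<in>{m\<in>{..<d}. l \<le> m}. 1 / fact (m - l) * a (d - m)) = - 1 / (fact (d - l) * of_nat (d - l))"
    if l: "l < d" for l
  proof -
    define n where "n = d - l"
    have "(\<Sum>m\<in>{m\<in>{..<d}. l \<le> m}. 1 / fact (m - l) * a (d - m)) = (\<Sum>j\<in>{1..n}. 1 / fact (n - j) * a j)"
      by (rule sum.reindex_bij_witness[of _ "\<lambda>j. d - j" "\<lambda>m. d - m"]) (auto simp: n_def)
    \<comment> \<open>The term \<open>j = 0\<close> can be added because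
      \<open>harm 0 = 0\<close>.\<close>
    also have "\<dots> = (\<Sum>j\<le>n. 1 / fact (n - j) * a j)"
      by (rule sum.mono_neutral_left) (auto simp: a_def harm_def not_le)
    also have "\<dots> = (\<Sum>j\<le>n. 1 / fact n * ((-1) ^ j * of_nat (n choose j) * harm j))"
      by (intro sum.cong refl) (simp add: a_def binomial_fact)
    also have "\<dots> = 1 / fact n * - inverse (of_nat n)"
      unfolding sum_distrib_left[symmetric]
      by (subst alternating_binomial_sum_harm) (use l in \<open>auto simp: n_def\<close>)
    finally show ?thesis by (simp add: n_def field_simps)
  qed
  have "(\<Sum>m<d. (-1) ^ m * bernoulli_poly_ho d w m (-1) / fact m * a (d - m)) =
        (\<Sum>m<d. \<Sum>l\<in>{l\<in>{..<d}. l \<le> m}. b l * (1 / fact (m - l) * a (d - m)))"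
    unfolding B sum_distrib_right by (intro sum.cong refl) auto
  also have "\<dots> = (\<Sum>l<d. \<Sum>m\<in>{m\<in>{..<d}. l \<le> m}. b l * (1 / fact (m - l) * a (d - m)))"
    by (rule sum.swap_restrict) auto
  also have "\<dots> = (\<Sum>l<d. (-1) ^ (l + 1) * bernoulli_num_ho d w l / (fact l * fact (d - l) * of_nat (d - l)))"
    unfolding sum_distrib_left[symmetric] by (intro sum.cong refl, subst inner) (auto simp: b_def)
  finally show ?thesis by (simp add: a_def)
qed

section \<open>Gamma quotients\<close>

text \<open>\<open>\<Gamma>(\<alpha> + m - d) / \<Gamma>(\<alpha>)\<close> as a rational function, which has the right value also at the
  non-positive integers, where \<^const>\<open>Gamma\<close> takes the junk value 0.\<close>

definition gamma_quot :: "nat \<Rightarrow> nat \<Rightarrow> complex \<Rightarrow> complex" where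
  "gamma_quot d m \<alpha> = (if m \<ge> d then pochhammer \<alpha> (m - d) else inverse (\<Prod>i=1..d-m. \<alpha> - of_nat i))"

lemma pochhammer_minus_eq_prod: "pochhammer (\<alpha> - of_nat j) j = (\<Prod>i=1..j. \<alpha> - of_nat i :: complex)"
  unfolding pochhammer_prod
  by (rule prod.reindex_bij_witness[of _ "\<lambda>i. j - i" "\<lambda>i. j - i"]) (auto simp: of_nat_diff)

lemma rGamma_times_Gamma:
  fixes z :: complex
  assumes "Re z > 0"
  shows "rGamma z * Gamma z = 1"
proof -
  have "Gamma z \<noteq> 0" using assms by (auto simp: Gamma_eq_zero_iff elim!: nonpos_Ints_cases)
  thus ?thesis by (simp add: rGamma_inverse_Gamma)
qed

text \<open>The functional equation, in the form for the entire function \<open>rGamma\<close>,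
  relates arguments differing by an integer without exceptional points. The hypothesis puts the
  argument of \<open>Gamma\<close> in the right half-plane, where \<open>Gamma\<close> and
  \<open>rGamma\<close> are reciprocal.\<close>

lemma gamma_quot_eq:
  assumes "Re \<alpha> > real d - real m"
  shows "rGamma \<alpha> * Gamma (\<alpha> + of_nat m - of_nat d) = gamma_quot d m \<alpha>"
proof (cases "m \<ge> d")
  case True
  define n where "n = m - d"
  have z: "\<alpha> + of_nat m - of_nat d = \<alpha> + of_nat n" using True by (simp add: n_def of_nat_diff)
  have "rGamma (\<alpha> + of_nat n) * Gamma (\<alpha> + of_nat n) = 1"
    by (rule rGamma_times_Gamma) (use assms True in \<open>simp add: n_def of_nat_diff\<close>)
  thus ?thesis
    using True by (simp add: z gamma_quot_def pochhammer_rGamma[of \<alpha> n] flip: n_def)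
next
  case False
  define j where "j = d - m"
  have z: "\<alpha> + of_nat m - of_nat d = \<alpha> - of_nat j" using False by (simp add: j_def of_nat_diff)
  have "rGamma (\<alpha> - of_nat j) * Gamma (\<alpha> - of_nat j) = 1"
    by (rule rGamma_times_Gamma) (use assms False in \<open>simp add: j_def of_nat_diff\<close>)
  hence "pochhammer (\<alpha> - of_nat j) j * (rGamma \<alpha> * Gamma (\<alpha> - of_nat j)) = 1"
    by (subst (asm) pochhammer_rGamma[of _ j]) (simp add: mult_ac)
  hence "rGamma \<alpha> * Gamma (\<alpha> - of_nat j) = inverse (pochhammer (\<alpha> - of_nat j) j)"
    by (metis inverse_unique)
  thus ?thesis
    using False by (simp add: z gamma_quot_def pochhammer_minus_eq_prod flip: j_def)
qed

lemma meromorphic_gamma_quot: "gamma_quot d m meromorphic_on A"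
proof (cases "m \<ge> d")
  case True
  thus ?thesis unfolding gamma_quot_def pochhammer_prod
    by (auto intro!: analytic_on_imp_meromorphic_on analytic_intros)
next
  case False
  have "(\<lambda>\<alpha>. inverse (\<Prod>i=1..d-m. \<alpha> - of_nat i)) meromorphic_on A"
    by (intro meromorphic_intros)
  thus ?thesis unfolding gamma_quot_def using False by simp
qed

text \<open>The poles can only be positive integers, all outside the open unit disc.\<close>

lemma holomorphic_gamma_quot: "gamma_quot d m holomorphic_on ball 0 1"
proof (cases "m \<ge> d")
  case True
  thus ?thesis unfolding gamma_quot_def pochhammer_prod by (auto intro!: holomorphic_intros)
next
  case False
  have "z - of_nat i \<noteq> 0" if "z \<in> ball 0 1" "i \<in> {1..d-m}" for z :: complex and i
    using that by auto
  hence "(\<lambda>\<alpha>. inverse (\<Prod>i=1..d-m. \<alpha> - of_nat i)) holomorphic_on ball 0 1"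
    by (intro holomorphic_intros) auto
  thus ?thesis unfolding gamma_quot_def using False by simp
qed

text \<open>The value at 0 is \<open>(-1) ^ j / fact j\<close>, and the logarithmic derivative there
  is the sum of the \<open>1 / i\<close>, that is \<open>harm j\<close>.\<close>

lemma has_field_derivative_inverse_prod_0:
  "((\<lambda>\<alpha>. inverse (\<Prod>i=1..j. \<alpha> - of_nat i)) has_field_derivative ((-1) ^ j / fact j * harm j :: complex)) (at 0)"
proof (induction j)
  case 0
  show ?case by (simp add: harm_def)
next
  case (Suc j)
  have P0: "(\<Prod>i=1..j. 0 - of_nat i :: complex) = (-1) ^ j * fact j"
    by (induction j) (auto simp: prod.atLeast_Suc_atMost_Suc_shift algebra_simps)
  have D: "((\<lambda>\<alpha>. inverse (\<alpha> - of_nat (Suc j))) has_field_derivative (- inverse (of_nat (Suc j) ^ 2) :: complex)) (at 0)"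
    by (auto intro!: derivative_eq_intros simp: power2_eq_square divide_simps simp del: of_nat_Suc)
  have eq: "(\<lambda>\<alpha>. inverse (\<Prod>i=1..Suc j. \<alpha> - of_nat i)) =
    (\<lambda>\<alpha>. inverse (\<Prod>i=1..j. \<alpha> - of_nat i) * inverse (\<alpha> - of_nat (Suc j) :: complex))"
    by (simp add: fun_eq_iff)
  show ?case unfolding eq
    by (rule DERIV_cong[OF DERIV_mult[OF Suc.IH D]], unfold P0)
       (simp add: harm_Suc field_simps power2_eq_square del: of_nat_Suc)
qed

lemma has_field_derivative_gamma_quot_0:
  assumes "m \<le> d"
  shows "(gamma_quot d m has_field_derivative ((-1) ^ (d - m) / fact (d - m) * harm (d - m))) (at 0)"
proof (cases "m = d")
  case True
  thus ?thesis by (simp add: gamma_quot_def [abs_def] harm_def)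
next
  case False
  with assms have "gamma_quot d m = (\<lambda>\<alpha>. inverse (\<Prod>i=1..d-m. \<alpha> - of_nat i))"
    by (simp add: gamma_quot_def fun_eq_iff)
  thus ?thesis using has_field_derivative_inverse_prod_0 by simp
qed

section \<open>Gluing the continuations to half-planes\<close>

definition barnes_partial :: "nat \<Rightarrow> (nat \<Rightarrow> complex) \<Rightarrow> nat \<Rightarrow> complex \<Rightarrow> complex" where
  "barnes_partial d w M \<alpha> = rGamma \<alpha> * mellin (barnes_remainder d w M) \<alpha>
                              + (\<Sum>m<M. barnes_coeff d w m * gamma_quot d m \<alpha>)"

context
  fixes d :: nat and w :: "nat \<Rightarrow> complex"
  assumes w: "\<And>i. i \<in> {1..d} \<Longrightarrow> Re (w i) > 0"
begin

lemma holomorphic_mellin_barnes_remainder: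
  "mellin (barnes_remainder d w M) holomorphic_on {\<alpha>. Re \<alpha> > real d - real M}"
proof -
  obtain c C where "c > 0"
    "\<And>t. t > 0 \<Longrightarrow> norm (barnes_remainder d w M t) \<le> C * t powr (real M - real d) * exp (- (c * t))"
    using barnes_remainder_bound[of d w M] w by blast
  thus ?thesis
    using holomorphic_mellin[OF continuous_on_barnes_remainder[OF w], of d _ M C "real M - real d" c] by simp
qed

text \<open>The additional term is a multiple of \<open>t powr (\<beta> - 1) * exp (- t)\<close>
  with \<beta> in the right half-plane, so its Mellin transform is a convergent Euler integral and
  linearity applies.\<close>

lemma mellin_barnes_remainder_Suc:
  assumes \<alpha>: "Re \<alpha> > real d - real M"
  shows "mellin (barnes_remainder d w (Suc M)) \<alpha> =
         mellin (barnes_remainder d w M) \<alpha> - barnes_coeff d w M * Gamma (\<alpha> + of_nat M - of_nat d)"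
proof -
  define \<beta> where "\<beta> = \<alpha> + of_nat M - of_nat d"
  have \<beta>: "Re \<beta> > 0" using \<alpha> by (simp add: \<beta>_def)
  have int: "set_integrable lborel {0<..} (\<lambda>t. of_real t powr (\<beta> - 1) * exp (- complex_of_real t))"
    by (rule set_integrable_mellin[where C = 1 and s = 0 and c = 1])
       (use \<beta> in \<open>auto intro!: continuous_intros\<close>)
  have "mellin (barnes_remainder d w (Suc M)) \<alpha> =
    (LBINT t:{0<..}. of_real t powr (\<alpha> - 1) * barnes_remainder d w M t -
                      barnes_coeff d w M * (of_real t powr (\<beta> - 1) * exp (- complex_of_real t)))"
    unfolding mellin_def
  proof (intro set_lebesgue_integral_cong allI impI)
    fix t :: real assume "t \<in> {0<..}"
    hence t: "t > 0" by simp
    have "complex_of_real t powr (\<beta> - 1) = complex_of_real t powr ((\<alpha> - 1) + of_nat M - of_nat d)"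
      by (simp add: \<beta>_def algebra_simps)
    also have "\<dots> = of_real t powr (\<alpha> - 1) * of_real t ^ M * inverse (of_real t ^ d)"
      using t unfolding powr_add powr_diff by (simp add: powr_nat field_simps)
    finally show "of_real t powr (\<alpha> - 1) * barnes_remainder d w (Suc M) t =
       of_real t powr (\<alpha> - 1) * barnes_remainder d w M t -
                      barnes_coeff d w M * (of_real t powr (\<beta> - 1) * exp (- complex_of_real t))"
      by (simp add: barnes_remainder_def algebra_simps)
  qed auto
  also have "\<dots> = mellin (barnes_remainder d w M) \<alpha> -
      barnes_coeff d w M * mellin (\<lambda>t. exp (- complex_of_real t)) \<beta>"
    unfolding mellin_def
    by (subst set_integral_diff(2)) (use int set_integrable_mellin_barnes_remainder[of d w M \<alpha>, OF w \<alpha>] in auto)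
  also have "mellin (\<lambda>t. exp (- complex_of_real t)) \<beta> = Gamma \<beta>"
    using mellin_exp[OF \<beta>, of 1] by simp
  finally show ?thesis by (simp add: \<beta>_def)
qed

lemma barnes_partial_Suc:
  assumes "Re \<alpha> > real d - real M"
  shows "barnes_partial d w (Suc M) \<alpha> = barnes_partial d w M \<alpha>"
  by (simp add: barnes_partial_def mellin_barnes_remainder_Suc[OF assms] algebra_simps
        flip: gamma_quot_eq[OF assms])

lemma barnes_partial_eq:
  assumes "Re \<alpha> > real d - real M" "Re \<alpha> > real d - real N"
  shows "barnes_partial d w M \<alpha> = barnes_partial d w N \<alpha>"
proof -
  have *: "barnes_partial d w (M + k) \<alpha> = barnes_partial d w M \<alpha>" if "Re \<alpha> > real d - real M" for M k
    using that by (induction k) (auto simp: barnes_partial_Suc)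
  show ?thesis
    using *[of M "N - M"] *[of N "M - N"] assms by (cases "M \<le> N") auto
qed

lemma meromorphic_barnes_partial: "barnes_partial d w M meromorphic_on {\<alpha>. Re \<alpha> > real d - real M}"
proof -
  have "mellin (barnes_remainder d w M) analytic_on {\<alpha>. Re \<alpha> > real d - real M}"
    using holomorphic_mellin_barnes_remainder by (simp add: analytic_on_open open_halfspace_Re_gt)
  hence "mellin (barnes_remainder d w M) meromorphic_on {\<alpha>. Re \<alpha> > real d - real M}"
    by (rule analytic_on_imp_meromorphic_on)
  moreover have "rGamma meromorphic_on {\<alpha>. Re \<alpha> > real d - real M}"
    by (intro analytic_on_imp_meromorphic_on holomorphic_on_imp_analytic_at analytic_rGamma)
  ultimately show ?thesis
    unfolding barnes_partial_def by (intro meromorphic_intros meromorphic_gamma_quot)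
qed

text \<open>The number of subtracted terms grows as \<alpha> moves left, so a single function covers
  the plane; \<open>Suc\<close> makes the inequality \<open>Re \<alpha> > d - M\<close> strict. Any
  other admissible \<open>M\<close> gives the same value by
  \<open>barnes_partial_eq\<close>.\<close>

definition barnes_continuation :: "complex \<Rightarrow> complex" where
  "barnes_continuation \<alpha> = barnes_partial d w (Suc (nat \<lceil>real d - Re \<alpha>\<rceil>)) \<alpha>"

lemma barnes_continuation_eq:
  assumes "Re \<alpha> > real d - real M"
  shows "barnes_continuation \<alpha> = barnes_partial d w M \<alpha>"
proof -
  have "real d - Re \<alpha> < real (Suc (nat \<lceil>real d - Re \<alpha>\<rceil>))" by linarith
  thus ?thesis unfolding barnes_continuation_def by (intro barnes_partial_eq) (use assms in linarith)+
qed

lemma eventually_barnes_continuation_eq: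
  assumes "Re \<alpha> > real d - real M"
  shows "eventually (\<lambda>z. barnes_continuation z = barnes_partial d w M z) (nhds \<alpha>)"
proof -
  have "eventually (\<lambda>z. z \<in> {z. Re z > real d - real M}) (nhds \<alpha>)"
    using assms by (intro eventually_nhds_in_open open_halfspace_Re_gt) auto
  thus ?thesis by eventually_elim (simp add: barnes_continuation_eq)
qed

lemma meromorphic_barnes_continuation: "barnes_continuation meromorphic_on UNIV"
proof (subst meromorphic_on_meromorphic_at, intro ballI)
  fix \<alpha> :: complex
  define M where "M = Suc (nat \<lceil>real d - Re \<alpha>\<rceil>)"
  have M: "Re \<alpha> > real d - real M" unfolding M_def by linarith
  have "barnes_partial d w M meromorphic_on {\<alpha>}"
    by (rule meromorphic_on_subset[OF meromorphic_barnes_partial]) (use M in auto)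
  also have "?this \<longleftrightarrow> barnes_continuation meromorphic_on {\<alpha>}"
    using eventually_barnes_continuation_eq[OF M]
    by (intro meromorphic_on_cong refl) (auto simp: eventually_nhds_conv_at eq_commute)
  finally show "barnes_continuation meromorphic_on {\<alpha>}" .
qed

text \<open>\<open>remove_sings\<close> normalises the values at poles and removable singularities,
  as \<open>nicely_meromorphic_on\<close> demands.\<close>

lemma barnes_zeta_h_eq: "barnes_zeta_h d w = remove_sings barnes_continuation"
proof (rule barnes_zeta_h_eqI)
  show "remove_sings barnes_continuation nicely_meromorphic_on UNIV"
    by (rule remove_sings_nicely_meromorphic meromorphic_barnes_continuation)+
  fix \<alpha> assume \<alpha>: "Re \<alpha> > real d"
  \<comment> \<open>With \<open>M = 0\<close> nothing is subtracted. The function is analytic for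
    \<open>Re \<alpha> > d\<close>, so \<open>remove_sings\<close> does not change its values
    there.\<close>
  have p0: "barnes_partial d w 0 = (\<lambda>\<alpha>. rGamma \<alpha> * mellin (barnes_kernel d w) \<alpha>)"
    by (simp add: barnes_partial_def barnes_remainder_0 fun_eq_iff)
  have "(\<lambda>\<alpha>. rGamma \<alpha> * mellin (barnes_kernel d w) \<alpha>) holomorphic_on {\<alpha>. Re \<alpha> > real d}"
    using holomorphic_mellin_barnes_remainder[of 0] by (intro holomorphic_intros) (simp add: barnes_remainder_0)
  hence "barnes_partial d w 0 analytic_on {\<alpha>}"
    unfolding p0 using \<alpha> by (subst analytic_at) (auto intro!: exI[of _ "{\<alpha>. Re \<alpha> > real d}"] open_halfspace_Re_gt)
  also have "?this \<longleftrightarrow> barnes_continuation analytic_on {\<alpha>}"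
    using eventually_barnes_continuation_eq[of 0 \<alpha>] \<alpha> by (intro analytic_at_cong) (auto simp: eq_commute)
  finally have "remove_sings barnes_continuation \<alpha> = barnes_continuation \<alpha>" by simp
  also have "\<dots> = barnes_partial d w 0 \<alpha>" using \<alpha> by (intro barnes_continuation_eq) simp
  also have "\<dots> = barnes_series_h d w \<alpha>"
    unfolding p0 by (rule barnes_series_h_eq_mellin[OF w \<alpha>, symmetric])
  finally show "remove_sings barnes_continuation \<alpha> = barnes_series_h d w \<alpha>" .
qed

text \<open>\<open>M = d + 1\<close> is the least number of terms whose half-plane
  \<open>Re \<alpha> > d - M\<close> contains 0. As \<open>rGamma\<close> has value 0 and derivative
  1 there, the product rule leaves just the value of the Mellin transform.\<close>

lemma has_field_derivative_barnes_zeta_h_0: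
  "(barnes_zeta_h d w has_field_derivative
     (mellin (barnes_remainder d w (Suc d)) 0 +
      (\<Sum>m<d. barnes_coeff d w m * ((-1) ^ (d - m) / fact (d - m) * harm (d - m))))) (at 0)"
proof -
  let ?S = "{\<alpha>. Re \<alpha> > - 1}"
  have holo: "mellin (barnes_remainder d w (Suc d)) holomorphic_on ?S"
    using holomorphic_mellin_barnes_remainder[of "Suc d"] by simp
  have D: "(mellin (barnes_remainder d w (Suc d)) has_field_derivative
             deriv (mellin (barnes_remainder d w (Suc d))) 0) (at 0)"
    by (rule holomorphic_derivI[OF holo]) (auto simp: open_halfspace_Re_gt)
  have G: "(rGamma has_field_derivative 1) (at (0 :: complex))"
    using has_field_derivative_rGamma_nonpos_int[where n = 0 and A = UNIV and 'a = complex] by simp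
  have "((\<lambda>\<alpha>. rGamma \<alpha> * mellin (barnes_remainder d w (Suc d)) \<alpha>) has_field_derivative
           mellin (barnes_remainder d w (Suc d)) 0) (at 0)"
    using DERIV_mult[OF G D] by (simp add: rGamma_eq_zero_iff)
  moreover have "((\<lambda>\<alpha>. \<Sum>m<Suc d. barnes_coeff d w m * gamma_quot d m \<alpha>) has_field_derivative
      (\<Sum>m<Suc d. barnes_coeff d w m * ((-1) ^ (d - m) / fact (d - m) * harm (d - m)))) (at 0)"
    by (intro DERIV_sum DERIV_cmult has_field_derivative_gamma_quot_0) auto
  ultimately have "(barnes_partial d w (Suc d) has_field_derivative
     (mellin (barnes_remainder d w (Suc d)) 0 +
      (\<Sum>m<Suc d. barnes_coeff d w m * ((-1) ^ (d - m) / fact (d - m) * harm (d - m))))) (at 0)"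
    unfolding barnes_partial_def [abs_def] by (rule DERIV_add)
  \<comment> \<open>The term \<open>m = d\<close> drops out since \<open>harm 0 = 0\<close>.\<close>
  hence P: "(barnes_partial d w (Suc d) has_field_derivative
     (mellin (barnes_remainder d w (Suc d)) 0 +
      (\<Sum>m<d. barnes_coeff d w m * ((-1) ^ (d - m) / fact (d - m) * harm (d - m))))) (at 0)"
    by (simp add: harm_def)
  have sub: "ball 0 1 \<subseteq> ?S"
  proof
    fix z :: complex assume "z \<in> ball 0 1"
    thus "z \<in> ?S" using abs_Re_le_cmod[of z] by auto
  qed
  \<comment> \<open>Analyticity at 0 ensures that \<open>remove_sings\<close> leaves the
    continuation unchanged in a whole neighbourhood, as needed to transfer the derivative.\<close>
  have "barnes_partial d w (Suc d) holomorphic_on ball 0 1"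
    unfolding barnes_partial_def [abs_def]
    by (intro holomorphic_intros holomorphic_gamma_quot holomorphic_on_subset[OF holo sub])
  hence "barnes_partial d w (Suc d) analytic_on {0}"
    by (subst analytic_at) (auto intro!: exI[of _ "ball 0 1"])
  also have ev: "eventually (\<lambda>z. barnes_continuation z = barnes_partial d w (Suc d) z) (nhds 0)"
    by (rule eventually_barnes_continuation_eq) simp
  hence "barnes_partial d w (Suc d) analytic_on {0} \<longleftrightarrow> barnes_continuation analytic_on {0}"
    by (intro analytic_at_cong) (auto simp: eq_commute)
  finally have "eventually (\<lambda>z. remove_sings barnes_continuation z = barnes_continuation z) (nhds 0)"
    by (rule eventually_remove_sings_eq_nhds)
  with ev have "eventually (\<lambda>z. barnes_zeta_h d w z = barnes_partial d w (Suc d) z) (nhds 0)"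
    unfolding barnes_zeta_h_eq by eventually_elim simp
  with P show ?thesis by (subst DERIV_cong_ev[OF refl _ refl])
qed

end

text \<open>Integrability belongs to the conclusion because the Lebesgue integral of a
  non-integrable function is 0 by default.\<close>

theorem mainTheorem12:
  fixes d :: nat and w :: "nat \<Rightarrow> complex"
  assumes "d \<ge> 1"
  assumes "\<And>i. i \<in> {1..d} \<Longrightarrow> Re (w i) > 0"
  shows "let integrand = (\<lambda>t :: real.
               inverse (of_real t) *
               (1 / (\<Prod>i=1..d. 1 - exp (- (w i * of_real t))) - 1 + exp (- of_real t)
                - inverse (of_real t ^ d) * exp (- of_real t) / (\<Prod>i=1..d. w i)
                  * (\<Sum>k=0..d. (-1) ^ k * bernoulli_poly_ho d w k (-1) * of_real t ^ k / fact k)))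
         in set_integrable lborel {0<..} integrand \<and>
            (barnes_zeta_h d w has_field_derivative
               (1 / (\<Prod>i=1..d. w i)
                  * (\<Sum>j=0..d-1. (-1) ^ (j + 1) * bernoulli_num_ho d w j
                                 / (fact j * fact (d - j) * of_nat (d - j)))
                + (LBINT t:{0<..}. integrand t))) (at 0)"
proof -
  define P where "P = (\<Prod>i=1..d. w i)"
  define integrand where "integrand = (\<lambda>t :: real.
               inverse (of_real t) *
               (1 / (\<Prod>i=1..d. 1 - exp (- (w i * of_real t))) - 1 + exp (- of_real t)
                - inverse (of_real t ^ d) * exp (- of_real t) / P
                  * (\<Sum>k=0..d. (-1) ^ k * bernoulli_poly_ho d w k (-1) * of_real t ^ k / fact k)))"
  have eq: "of_real t powr (0 - 1) * barnes_remainder d w (Suc d) t = integrand t" if t: "t > 0" for t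
  proof -
    define U where "U = (\<Sum>k=0..d. (-1) ^ k * bernoulli_poly_ho d w k (-1) * of_real t ^ k / fact k)"
    \<comment> \<open>Among these coefficients only \<open>m = d\<close> has a nonzero correction,
      namely 1. After multiplication by \<open>inverse (t ^ d) * exp (- t)\<close> it becomes the
      separate \<open>exp (- t)\<close> of the integrand.\<close>
    have "(\<Sum>m<Suc d. barnes_coeff d w m * of_real t ^ m) =
       (\<Sum>k=0..d. (-1) ^ k * bernoulli_poly_ho d w k (-1) / (fact k * P) * of_real t ^ k) - of_real t ^ d"
      by (simp add: barnes_coeff_def P_def algebra_simps sum_subtractf atLeast0AtMost
            flip: lessThan_Suc_atMost)
    also have "(\<Sum>k=0..d. (-1) ^ k * bernoulli_poly_ho d w k (-1) / (fact k * P) * of_real t ^ k) =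
       U / P" by (simp add: U_def sum_divide_distrib mult_ac)
    finally have "barnes_remainder d w (Suc d) t =
        barnes_kernel d w t - inverse (of_real t ^ d) * exp (- of_real t) * (U / P - of_real t ^ d)"
      unfolding barnes_remainder_def by (rule arg_cong)
    also have "\<dots> = barnes_kernel d w t + exp (- of_real t) - inverse (of_real t ^ d) * exp (- of_real t) / P * U"
      using t by (simp add: field_simps)
    finally show ?thesis
      using t by (simp add: integrand_def barnes_kernel_def powr_minus U_def)
  qed
  have "set_integrable lborel {0<..} (\<lambda>t. of_real t powr (0 - 1) * barnes_remainder d w (Suc d) t)"
    by (rule set_integrable_mellin_barnes_remainder) (use assms in auto)
  also have "?this \<longleftrightarrow> set_integrable lborel {0<..} integrand"
    by (intro set_integrable_cong refl) (use eq in auto)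
  finally have int: "set_integrable lborel {0<..} integrand" .
  have I: "mellin (barnes_remainder d w (Suc d)) 0 = (LBINT t:{0<..}. integrand t)"
    unfolding mellin_def by (intro set_lebesgue_integral_cong) (use eq in auto)
  \<comment> \<open>For \<open>m < d\<close> the correction in \<open>barnes_coeff\<close> vanishes,
    so only Bernoulli polynomials at -1 remain and \<open>sum_bernoulli_poly_ho_harm\<close>
    applies.\<close>
  have "(\<Sum>m<d. barnes_coeff d w m * ((-1) ^ (d - m) / fact (d - m) * harm (d - m))) =
        1 / P * (\<Sum>m<d. (-1) ^ m * bernoulli_poly_ho d w m (-1) / fact m *
                     ((-1) ^ (d - m) / fact (d - m) * harm (d - m)))"
    unfolding sum_distrib_left by (intro sum.cong refl) (simp add: barnes_coeff_def P_def)
  also have "\<dots> = 1 / P * (\<Sum>j=0..d-1. (-1) ^ (j + 1) * bernoulli_num_ho d w j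
                                 / (fact j * fact (d - j) * of_nat (d - j)))"
    unfolding sum_bernoulli_poly_ho_harm
    by (intro arg_cong2[where f = "(*)"] sum.cong refl) (use assms(1) in auto)
  finally have "(barnes_zeta_h d w has_field_derivative
               (1 / P * (\<Sum>j=0..d-1. (-1) ^ (j + 1) * bernoulli_num_ho d w j
                                 / (fact j * fact (d - j) * of_nat (d - j)))
                + (LBINT t:{0<..}. integrand t))) (at 0)"
    using has_field_derivative_barnes_zeta_h_0[of d w, OF assms(2)] by (simp only: I add.commute)
  with int show ?thesis
    unfolding Let_def integrand_def P_def by blast
qed

end
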